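(* Let $p\in(0,\infty)$, let $\mathfrak N_1$ and $\mathfrak N_2$ be two finite factors, and let $\psi:\mathscr U(\mathfrak N_1)\to\mathscr U(\mathfrak N_2)$ be a surjective $L^p$-isometry such that $\psi(I)=I$. Then for every $U\in\mathscr U(\mathfrak N_1)$, $U^*=U$ if and only if $\psi(U)^*=\psi(U)$.
   Context: A finite factor is a von Neumann algebra factor admitting a (unique, faithful, normal) tracial state, i.e. $M_n(\mathbb C)$ or a $\mathrm{II}_1$ factor. For a finite factor $\mathfrak N$ with tracial state $\tau$, $\mathscr U(\mathfrak N)$ is its unitary group and $\|A\|_p:=\tau(|A|^p)^{1/p}$. A map $\psi:\mathscr U(\mathfrak N_1)\to\mathscr U(\mathfrak N_2)$ is an $L^p$-isometry if $\|U-V\|_p=\|\psi(U)-\psi(V)\|_p$ for all $U,V\in\mathscr U(\mathfrak N_1)$, each side computed with the tracial state of the respective factor. *)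

theory Defs
  imports "HOL-Analysis.Analysis" "HOL-Computational_Algebra.Polynomial"
begin

text \<open>
  Complex Hilbert spaces. The inner product is conjugate-linear in its first argument; the norm
  and the topology come from \<^class>\<open>real_inner\<close>, whose real inner product is the real part.
\<close>

class chilbert_space = real_inner + complete_space +
  fixes scaleC :: "complex \<Rightarrow> 'a \<Rightarrow> 'a" (infixr "*\<^sub>C" 75)
    and cinner :: "'a \<Rightarrow> 'a \<Rightarrow> complex"
  assumes scaleC_add_right: "c *\<^sub>C (x + y) = c *\<^sub>C x + c *\<^sub>C y"
    and scaleC_add_left: "(c + d) *\<^sub>C x = c *\<^sub>C x + d *\<^sub>C x"
    and scaleC_scaleC: "c *\<^sub>C (d *\<^sub>C x) = (c * d) *\<^sub>C x"
    and scaleR_scaleC: "scaleR r x = complex_of_real r *\<^sub>C x"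
    and cinner_commute: "cinner x y = cnj (cinner y x)"
    and cinner_add_right: "cinner x (y + z) = cinner x y + cinner x z"
    and cinner_scaleC_right: "cinner x (c *\<^sub>C y) = c * cinner x y"
    and inner_Re_cinner: "inner x y = Re (cinner x y)"

lemma norm_scaleC: "norm (c *\<^sub>C x) = cmod c * norm (x::'a::chilbert_space)"
proof -
  have left: "cinner (c *\<^sub>C x) y = cnj c * cinner x y" for y
    by (metis cinner_commute cinner_scaleC_right complex_cnj_mult complex_cnj_cnj)
  have "inner (c *\<^sub>C x) (c *\<^sub>C x) = Re ((c * cnj c) * cinner x x)"
    by (simp add: inner_Re_cinner left cinner_scaleC_right mult_ac)
  also have "\<dots> = (cmod c)\<^sup>2 * inner x x"
    by (simp add: inner_Re_cinner flip: complex_norm_square of_real_power)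
  finally show ?thesis
    by (simp add: norm_eq_sqrt_inner real_sqrt_mult)
qed

lemma bounded_linear_scaleC: "bounded_linear ((*\<^sub>C) c :: 'a::chilbert_space \<Rightarrow> 'a)"
  by (rule bounded_linear_intro[where K = "cmod c"])
     (auto simp: scaleC_add_right scaleR_scaleC scaleC_scaleC norm_scaleC mult.commute)

text \<open>
  Operators live in the type of bounded real-linear maps; \<open>B(H)\<close> is the subset of complex-linear
  ones.
\<close>

type_synonym 'a op = "'a \<Rightarrow>\<^sub>L 'a"

definition bounded_ops :: "('a::chilbert_space) op set" where
  "bounded_ops = {A. \<forall>c x. blinfun_apply A (c *\<^sub>C x) = c *\<^sub>C blinfun_apply A x}"

lift_definition scalar_op :: "complex \<Rightarrow> ('a::chilbert_space) op" is "\<lambda>c x. c *\<^sub>C x"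
  by (rule bounded_linear_scaleC)

definition adj :: "('a::chilbert_space) op \<Rightarrow> 'a op" where
  "adj A = (THE B. \<forall>x y. cinner (blinfun_apply A x) y = cinner x (blinfun_apply B y))"

definition positive_op :: "('a::chilbert_space) op \<Rightarrow> bool" where
  "positive_op A \<longleftrightarrow> A \<in> bounded_ops \<and> (\<forall>x. cinner x (blinfun_apply A x) \<in> \<real>\<^sub>\<ge>\<^sub>0)"

definition op_le :: "('a::chilbert_space) op \<Rightarrow> 'a op \<Rightarrow> bool" where
  "op_le A B \<longleftrightarrow> positive_op (B - A)"

definition spectrum :: "('a::chilbert_space) op \<Rightarrow> complex set" where
  "spectrum A = {c. \<not> (\<exists>B\<in>bounded_ops. B o\<^sub>L (A - scalar_op c) = id_blinfun
                                      \<and> (A - scalar_op c) o\<^sub>L B = id_blinfun)}"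

definition op_poly :: "real poly \<Rightarrow> ('a::chilbert_space) op \<Rightarrow> 'a op" where
  "op_poly q A = (\<Sum>i\<le>degree q. scaleR (coeff q i) (((o\<^sub>L) A ^^ i) id_blinfun))"

text \<open>
  Continuous functional calculus of a self-adjoint operator (whose spectrum is real): the norm
  limit of \<open>q\<^sub>n(A)\<close> for real polynomials \<open>q\<^sub>n\<close> converging to \<open>f\<close> uniformly on the spectrum.
\<close>

definition cfc :: "(real \<Rightarrow> real) \<Rightarrow> ('a::chilbert_space) op \<Rightarrow> 'a op" where
  "cfc f A = (THE B. \<exists>q. uniform_limit {t. complex_of_real t \<in> spectrum A}
                           (\<lambda>n. poly (q n)) f sequentially
                       \<and> (\<lambda>n. op_poly (q n) A) \<longlonglongrightarrow> B)"

definition op_abs :: "('a::chilbert_space) op \<Rightarrow> 'a op" where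
  "op_abs A = cfc sqrt (adj A o\<^sub>L A)"

definition op_powr :: "('a::chilbert_space) op \<Rightarrow> real \<Rightarrow> 'a op" where
  "op_powr A p = cfc (\<lambda>t. t powr p) A"

definition commutant :: "('a::chilbert_space) op set \<Rightarrow> 'a op set" where
  "commutant S = {B \<in> bounded_ops. \<forall>A\<in>S. A o\<^sub>L B = B o\<^sub>L A}"

definition von_neumann_algebra :: "('a::chilbert_space) op set \<Rightarrow> bool" where
  "von_neumann_algebra N \<longleftrightarrow>
     N \<subseteq> bounded_ops \<and> adj ` N \<subseteq> N \<and> commutant (commutant N) = N"

definition factor :: "('a::chilbert_space) op set \<Rightarrow> bool" where
  "factor N \<longleftrightarrow> von_neumann_algebra N \<and> N \<inter> commutant N = range scalar_op"

definition tracial_state :: "('a::chilbert_space) op set \<Rightarrow> ('a op \<Rightarrow> complex) \<Rightarrow> bool" where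
  "tracial_state N \<tau> \<longleftrightarrow>
     (\<forall>A\<in>N. \<forall>B\<in>N. \<tau> (A + B) = \<tau> A + \<tau> B) \<and>
     (\<forall>c. \<forall>A\<in>N. \<tau> (scalar_op c o\<^sub>L A) = c * \<tau> A) \<and>
     (\<forall>A\<in>N. positive_op A \<longrightarrow> \<tau> A \<in> \<real>\<^sub>\<ge>\<^sub>0) \<and>
     \<tau> id_blinfun = 1 \<and>
     (\<forall>A\<in>N. \<forall>B\<in>N. \<tau> (A o\<^sub>L B) = \<tau> (B o\<^sub>L A))"

definition faithful_on :: "('a::chilbert_space) op set \<Rightarrow> ('a op \<Rightarrow> complex) \<Rightarrow> bool" where
  "faithful_on N \<tau> \<longleftrightarrow> (\<forall>A\<in>N. positive_op A \<and> \<tau> A = 0 \<longrightarrow> A = 0)"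

text \<open>
  Normality: \<open>\<tau>\<close> preserves suprema of upward directed families of positive elements that have a
  supremum.
\<close>

definition normal_on :: "('a::chilbert_space) op set \<Rightarrow> ('a op \<Rightarrow> complex) \<Rightarrow> bool" where
  "normal_on N \<tau> \<longleftrightarrow>
     (\<forall>D S. D \<noteq> {} \<and> D \<subseteq> {A \<in> N. positive_op A} \<and>
            (\<forall>A\<in>D. \<forall>B\<in>D. \<exists>C\<in>D. op_le A C \<and> op_le B C) \<and>
            S \<in> N \<and> (\<forall>A\<in>D. op_le A S) \<and>
            (\<forall>T\<in>N. (\<forall>A\<in>D. op_le A T) \<longrightarrow> op_le S T)
        \<longrightarrow> Re (\<tau> S) = (SUP A\<in>D. Re (\<tau> A)))"

text \<open>
  A tracial state of a factor is unique on \<open>N\<close>, so \<open>factor_trace N \<tau>\<close> says that \<open>\<tau>\<close> is the tracial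
  state of \<open>N\<close> (its values outside \<open>N\<close> are irrelevant).
\<close>

definition factor_trace :: "('a::chilbert_space) op set \<Rightarrow> ('a op \<Rightarrow> complex) \<Rightarrow> bool" where
  "factor_trace N \<tau> \<longleftrightarrow> tracial_state N \<tau> \<and> faithful_on N \<tau> \<and> normal_on N \<tau>"

definition finite_factor :: "('a::chilbert_space) op set \<Rightarrow> bool" where
  "finite_factor N \<longleftrightarrow> factor N \<and> (\<exists>\<tau>. factor_trace N \<tau>)"

definition unitary_group :: "('a::chilbert_space) op set \<Rightarrow> 'a op set" where
  "unitary_group N = {U \<in> N. adj U o\<^sub>L U = id_blinfun \<and> U o\<^sub>L adj U = id_blinfun}"

definition Lp_norm :: "(('a::chilbert_space) op \<Rightarrow> complex) \<Rightarrow> real \<Rightarrow> 'a op \<Rightarrow> real" where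
  "Lp_norm \<tau> p A = Re (\<tau> (op_powr (op_abs A) p)) powr (1 / p)"

definition Lp_isometry ::
  "real \<Rightarrow> ('a::chilbert_space) op set \<Rightarrow> ('a op \<Rightarrow> complex)
        \<Rightarrow> ('b::chilbert_space) op set \<Rightarrow> ('b op \<Rightarrow> complex) \<Rightarrow> ('a op \<Rightarrow> 'b op) \<Rightarrow> bool" where
  "Lp_isometry p N\<^sub>1 \<tau>\<^sub>1 N\<^sub>2 \<tau>\<^sub>2 \<psi> \<longleftrightarrow>
     \<psi> ` unitary_group N\<^sub>1 \<subseteq> unitary_group N\<^sub>2 \<and>
     (\<forall>U\<in>unitary_group N\<^sub>1. \<forall>V\<in>unitary_group N\<^sub>1.
        Lp_norm \<tau>\<^sub>1 p (U - V) = Lp_norm \<tau>\<^sub>2 p (\<psi> U - \<psi> V))"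

end

theory Submission
  imports Defs "HOL-Computational_Algebra.Fundamental_Theorem_Algebra"
begin

text \<open>
  Put \<open>s = p/2\<close> and \<open>B = |U - 1|\<^sup>2 = 2 - U - U\<^sup>*\<close>, so that \<open>4 - B = |U + 1|\<^sup>2\<close> and
  \<open>B(4 - B) = |U - U\<^sup>*|\<^sup>2\<close>. Since \<open>-1\<close> is the only unitary at maximal distance from \<open>1\<close>, the isometry fixes
  it, and hence preserves \<open>\<tau>(B\<^sup>s + (4 - B)\<^sup>s)\<close>. If \<open>p \<noteq> 2\<close>, then \<open>t\<^sup>s + (4 - t)\<^sup>s - 4\<^sup>s\<close> has a strict sign on
  the open interval from 0 to 4, even bounded away from 0 by a multiple of \<open>t(4 - t)\<close>; by faithfulness
  the trace above equals \<open>4\<^sup>s\<close> exactly if \<open>B(4 - B) = 0\<close>, that is, \<open>U = U\<^sup>*\<close>.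

  For \<open>p = 2\<close> this trace is constant, but the isometry preserves \<open>Re \<tau>(U\<^sup>*V)\<close>. A symmetry \<open>S\<close> satisfies
  \<open>|Re \<tau>(S(V - 1))| \<le> 1 - Re \<tau>(V)\<close> for all unitaries \<open>V\<close>. Conversely, testing this inequality for a unitary
  \<open>T\<close> on unitaries \<open>W = 1 + 2tJ + O(t\<^sup>2)\<close>, where \<open>J\<close> is the skew-adjoint part of \<open>T\<close>, forces \<open>J = 0\<close>.
\<close>

subsection \<open>Hilbert space operators and adjoints\<close>

instance chilbert_space \<subseteq> banach ..

lemma scaleC_zero_left [simp]: "0 *\<^sub>C x = (0::'a::chilbert_space)"
  by (metis norm_eq_zero norm_scaleC norm_zero mult_zero_left)

lemma scaleC_zero_right [simp]: "c *\<^sub>C 0 = (0::'a::chilbert_space)"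
  by (metis norm_eq_zero norm_scaleC norm_zero mult_zero_right)

lemma scaleC_one [simp]: "1 *\<^sub>C x = (x::'a::chilbert_space)"
  by (metis of_real_1 scaleR_one scaleR_scaleC)

lemma scaleC_minus_right: "c *\<^sub>C (- x) = - (c *\<^sub>C (x::'a::chilbert_space))"
  by (rule linear_simps(4)[OF bounded_linear_scaleC])

lemma scaleC_diff_right: "c *\<^sub>C (x - y) = c *\<^sub>C x - c *\<^sub>C (y::'a::chilbert_space)"
  by (rule linear_simps(2)[OF bounded_linear_scaleC])

lemma scaleC_scaleR: "c *\<^sub>C (r *\<^sub>R x) = r *\<^sub>R (c *\<^sub>C (x::'a::chilbert_space))"
  by (simp add: scaleR_scaleC scaleC_scaleC mult.commute)

lemma cinner_scaleC_left: "cinner (c *\<^sub>C x) (y::'a::chilbert_space) = cnj c * cinner x y"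
  by (metis cinner_commute cinner_scaleC_right complex_cnj_mult complex_cnj_cnj)

text \<open>Multiplication by the imaginary unit recovers the imaginary part of
  \<open>cinner\<close> from the real inner product, so that arguments about adjoints can be carried
  out with \<open>inner\<close> alone.\<close>

lemma inner_scaleC_ii:
  "inner (\<i> *\<^sub>C x) y = Im (cinner x (y::'a::chilbert_space))"
  "inner x (\<i> *\<^sub>C y) = - Im (cinner x (y::'a::chilbert_space))"
  by (simp_all add: inner_Re_cinner cinner_scaleC_left cinner_scaleC_right)

lemma inner_scaleC_cnj:
  "inner (c *\<^sub>C x) y = inner x (cnj c *\<^sub>C (y::'a::chilbert_space))"
  by (simp add: inner_Re_cinner cinner_scaleC_left cinner_scaleC_right)

text \<open>Unless \<open>f\<close> vanishes, completeness gives a vector \<open>u\<close> of least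
  norm in the closed hyperplane \<open>f x = 1\<close>. It is orthogonal to the kernel of
  \<open>f\<close>, so \<open>f\<close> is the inner product with \<open>u\<close>, up to the factor
  \<open>1 / inner u u\<close>.\<close>

lemma riesz_representation:
  fixes f :: "'a::{real_inner,complete_space} \<Rightarrow> real"
  assumes "bounded_linear f"
  shows "\<exists>v. \<forall>x. f x = inner v x"
proof (cases "\<forall>x. f x = 0")
  case True
  then show ?thesis by (intro exI[of _ 0]) simp
next
  case False
  interpret f: bounded_linear f by fact
  define K where "K = {x. f x = 1}"
  from False obtain x0 where "f x0 \<noteq> 0" by blast
  then have "inverse (f x0) *\<^sub>R x0 \<in> K" by (simp add: K_def f.scaleR)
  then have Kne: "K \<noteq> {}" by blast
  have "closed K" unfolding K_def
    by (intro closed_Collect_eq continuous_intros f.continuous_on)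
  define d where "d = Inf (norm ` K)"
  have bdd: "bdd_below (norm ` K)" by (rule bdd_belowI[of _ 0]) auto
  have d_le: "d \<le> norm x" if "x \<in> K" for x
    unfolding d_def using that bdd by (intro cInf_lower) auto
  have d0: "0 \<le> d" unfolding d_def using Kne by (intro cInf_greatest) auto
  have "\<exists>x\<in>K. norm x < d + inverse (real (Suc n))" for n
    using cInf_lessD[of "norm ` K" "d + inverse (real (Suc n))"] Kne
    unfolding d_def by fastforce
  then obtain X where XK: "\<And>n. X n \<in> K" and Xn: "\<And>n. norm (X n) < d + inverse (real (Suc n))"
    by metis
  have lim_n: "(\<lambda>n. norm (X n)) \<longlonglongrightarrow> d"
  proof (rule tendsto_sandwich[where f = "\<lambda>_. d" and h = "\<lambda>n. d + inverse (real (Suc n))"])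
    show "(\<lambda>n. d + inverse (real (Suc n))) \<longlonglongrightarrow> d"
      using tendsto_add[OF tendsto_const LIMSEQ_inverse_real_of_nat, of d] by simp
  qed (use d_le XK Xn in \<open>auto intro!: always_eventually less_imp_le simp del: of_nat_Suc\<close>)
  have "Cauchy X"
  proof (rule metric_CauchyI)
    fix e :: real assume "0 < e"
    \<comment> \<open>The midpoint of two points of \<open>K\<close> again has norm at least
      \<open>d\<close>; in the parallelogram identity the tolerance \<open>e^2 / 4\<close> then
      counts four times and bounds the squared distance by \<open>e^2\<close>.\<close>
    have "(\<lambda>n. (norm (X n))\<^sup>2) \<longlonglongrightarrow> d\<^sup>2" using lim_n by (intro tendsto_intros)
    then have "\<forall>\<^sub>F n in sequentially. (norm (X n))\<^sup>2 < d\<^sup>2 + e\<^sup>2 / 4"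
      using \<open>0 < e\<close> by (intro order_tendstoD) auto
    then obtain M where M: "\<And>n. n \<ge> M \<Longrightarrow> (norm (X n))\<^sup>2 < d\<^sup>2 + e\<^sup>2 / 4"
      by (auto simp: eventually_sequentially)
    show "\<exists>M. \<forall>m\<ge>M. \<forall>n\<ge>M. dist (X m) (X n) < e"
    proof (intro exI allI impI)
      fix m n assume mn: "m \<ge> M" "n \<ge> M"
      have "(1/2) *\<^sub>R (X m + X n) \<in> K"
        using XK[of m] XK[of n] by (simp add: K_def f.scaleR f.add)
      then have "d \<le> norm ((1/2) *\<^sub>R (X m + X n))" by (rule d_le)
      then have "(2 * d)\<^sup>2 \<le> (norm (X m + X n))\<^sup>2"
        using d0 by (intro power_mono) auto
      moreover have "(norm (X m - X n))\<^sup>2 + (norm (X m + X n))\<^sup>2 = 2 * (norm (X m))\<^sup>2 + 2 * (norm (X n))\<^sup>2"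
        by (simp add: power2_norm_eq_inner algebra_simps)
      ultimately have "(norm (X m - X n))\<^sup>2 < e\<^sup>2"
        using M[OF mn(1)] M[OF mn(2)] by (simp add: power_mult_distrib)
      then show "dist (X m) (X n) < e"
        using \<open>0 < e\<close> by (simp add: dist_norm power_less_imp_less_base)
    qed
  qed
  then obtain u where u: "X \<longlonglongrightarrow> u" using Cauchy_convergent_iff convergent_def by blast
  have uK: "u \<in> K" using closed_sequentially[OF \<open>closed K\<close>] XK u by blast
  have nu: "norm u = d" using LIMSEQ_unique[OF tendsto_norm[OF u] lim_n] .
  have orth: "inner u z = 0" if "f z = 0" for z
  proof (rule ccontr)
    assume nz: "inner u z \<noteq> 0"
    then have z: "inner z z > 0" by auto
    \<comment> \<open>This \<open>t\<close> minimises the quadratic function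
      \<open>norm (u + t z)^2\<close>. Its minimum lies strictly below \<open>norm u^2\<close>
      unless \<open>inner u z = 0\<close>.\<close>
    define t where "t = - inner u z / inner z z"
    have "u + t *\<^sub>R z \<in> K" using uK that by (simp add: K_def f.scaleR f.add)
    then have "(norm u)\<^sup>2 \<le> (norm (u + t *\<^sub>R z))\<^sup>2" using d_le nu by (intro power_mono) auto
    also have "\<dots> = (norm u)\<^sup>2 + 2 * t * inner u z + t * t * inner z z"
      by (simp add: power2_norm_eq_inner algebra_simps inner_commute)
    also have "\<dots> = (norm u)\<^sup>2 - (inner u z)\<^sup>2 / inner z z"
      using z by (simp add: t_def field_simps power2_eq_square)
    finally show False using nz z by (simp add: divide_le_0_iff)
  qed
  have "f u = 1" using uK by (simp add: K_def)
  then have unz: "inner u u \<noteq> 0" using f.zero by auto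
  have "f x = inner ((1 / inner u u) *\<^sub>R u) x" for x
  proof -
    have "inner u (x - f x *\<^sub>R u) = 0"
      using \<open>f u = 1\<close> by (intro orth) (simp add: f.diff f.scaleR)
    then show ?thesis using unz by (simp add: inner_diff_right field_simps)
  qed
  then show ?thesis by blast
qed

lemma bounded_opsI: "(\<And>c x. blinfun_apply A (c *\<^sub>C x) = c *\<^sub>C blinfun_apply A x) \<Longrightarrow> A \<in> bounded_ops"
  by (simp add: bounded_ops_def)

lemma bounded_ops_scaleC: "A \<in> bounded_ops \<Longrightarrow> blinfun_apply A (c *\<^sub>C x) = c *\<^sub>C blinfun_apply A x"
  by (simp add: bounded_ops_def)

lemma scalar_op_apply [simp]: "blinfun_apply (scalar_op c) x = c *\<^sub>C x"
  by (transfer) simp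

lemma bounded_ops_closed [simp, intro]:
  "id_blinfun \<in> bounded_ops" "0 \<in> bounded_ops" "scalar_op c \<in> bounded_ops"
  "A \<in> bounded_ops \<Longrightarrow> B \<in> bounded_ops \<Longrightarrow> A + B \<in> bounded_ops"
  "A \<in> bounded_ops \<Longrightarrow> B \<in> bounded_ops \<Longrightarrow> A - B \<in> bounded_ops"
  "A \<in> bounded_ops \<Longrightarrow> - A \<in> bounded_ops"
  "A \<in> bounded_ops \<Longrightarrow> r *\<^sub>R A \<in> bounded_ops"
  "A \<in> bounded_ops \<Longrightarrow> B \<in> bounded_ops \<Longrightarrow> A o\<^sub>L B \<in> bounded_ops"
  by (auto intro!: bounded_opsI simp: bounded_ops_scaleC blinfun.bilinear_simps scaleC_add_right
      scaleC_diff_right scaleC_minus_right scaleC_scaleR scaleC_scaleC mult.commute)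

text \<open>Riesz representation of \<open>inner (A x) y\<close> as a functional of
  \<open>x\<close>, for each \<open>y\<close>. Uniqueness of the representing vector makes it linear
  in \<open>y\<close>, and testing with \<open>x = g y\<close> bounds it.\<close>

lemma ex_real_adjoint:
  fixes A :: "('a::{real_inner,complete_space}) \<Rightarrow>\<^sub>L 'a"
  shows "\<exists>B. \<forall>x y. inner (blinfun_apply A x) y = inner x (blinfun_apply B y)"
proof -
  have "\<exists>v. \<forall>x. inner (A x) y = inner v x" for y
    by (intro riesz_representation bounded_linear_inner_left_comp blinfun.bounded_linear_right)
  then obtain g where g: "\<And>x y. inner (A x) y = inner x (g y)"
    by (metis inner_commute)
  have eqI: "u = v" if "\<And>x. inner x u = inner x v" for u v :: 'a
    using that by (metis inner_commute vector_eq_rdot)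
  have "bounded_linear g"
  proof (rule bounded_linear_intro[where K = "norm A"])
    fix x y show "g (x + y) = g x + g y"
      by (rule eqI) (simp add: inner_add_right flip: g)
  next
    fix r x show "g (r *\<^sub>R x) = r *\<^sub>R g x"
      by (rule eqI) (simp flip: g)
  next
    fix y
    have "norm (g y) * norm (g y) = inner (A (g y)) y"
      by (simp add: g power2_eq_square flip: power2_norm_eq_inner)
    also have "\<dots> \<le> norm (A (g y)) * norm y" by (rule norm_cauchy_schwarz)
    also have "\<dots> \<le> (norm A * norm (g y)) * norm y"
      by (intro mult_right_mono norm_blinfun) auto
    finally have "norm (g y) * norm (g y) \<le> norm (g y) * (norm y * norm A)" by (simp add: mult_ac)
    then show "norm (g y) \<le> norm y * norm A"
      by (cases "norm (g y) = 0") auto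
  qed
  then show ?thesis
    by (intro exI[of _ "Blinfun g"]) (simp add: bounded_linear_Blinfun_apply g)
qed

text \<open>The imaginary part of \<open>cinner (A x) y\<close> is the real inner product with
  \<open>x\<close> multiplied by the imaginary unit, which complex linearity of \<open>A\<close>
  lets pass through \<open>A\<close>. This reduces \<open>adj\<close> to the real adjoint.\<close>

lemma cinner_adjoint_iff:
  assumes "A \<in> bounded_ops"
  shows "(\<forall>x y. cinner (blinfun_apply A x) y = cinner x (blinfun_apply B y)) \<longleftrightarrow>
         (\<forall>x y. inner (blinfun_apply A x) y = inner x (blinfun_apply B y))" (is "?l \<longleftrightarrow> ?r")
proof
  assume ?l then show ?r by (simp add: inner_Re_cinner)
next
  assume r: ?r
  show ?l
  proof (intro allI complex_eqI)
    fix x y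
    show "Re (cinner (A x) y) = Re (cinner x (B y))" using r by (simp flip: inner_Re_cinner)
    show "Im (cinner (A x) y) = Im (cinner x (B y))"
      using r assms by (metis bounded_ops_scaleC inner_scaleC_ii(1))
  qed
qed

lemma inner_right_eqI: "(\<And>x. inner x u = inner x v) \<Longrightarrow> u = (v::'a::real_inner)"
  by (metis inner_commute vector_eq_rdot)

lemma adj_eqI:
  assumes "A \<in> bounded_ops" "\<And>x y. inner (blinfun_apply A x) y = inner x (blinfun_apply B y)"
  shows "adj A = B"
  unfolding adj_def cinner_adjoint_iff[OF assms(1)]
proof (rule the_equality)
  fix C assume "\<forall>x y. inner (A x) y = inner x (blinfun_apply C y)"
  then have "C y = B y" for y by - (rule inner_right_eqI, simp flip: assms(2))
  then show "C = B" by (rule blinfun_eqI)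
qed (use assms(2) in blast)

lemma inner_adj:
  assumes "A \<in> bounded_ops"
  shows "inner (blinfun_apply A x) y = inner x (blinfun_apply (adj A) y)"
proof -
  obtain B where B: "\<And>x y. inner (A x) y = inner x (blinfun_apply B y)" using ex_real_adjoint[of A] by blast
  then show ?thesis using adj_eqI[OF assms, of B] by simp
qed

lemma inner_adj':
  assumes "A \<in> bounded_ops"
  shows "inner x (blinfun_apply A y) = inner (blinfun_apply (adj A) x) y"
  by (metis assms inner_adj inner_commute)

lemma adj_in_bounded_ops [simp, intro]: "A \<in> bounded_ops \<Longrightarrow> adj A \<in> bounded_ops"
  by (rule bounded_opsI, rule inner_right_eqI)
     (metis bounded_ops_scaleC inner_adj inner_scaleC_cnj complex_cnj_cnj)

lemma adj_simps [simp]: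
  "adj id_blinfun = id_blinfun"
  "adj (scalar_op c) = scalar_op (cnj c)"
  "A \<in> bounded_ops \<Longrightarrow> B \<in> bounded_ops \<Longrightarrow> adj (A + B) = adj A + adj B"
  "A \<in> bounded_ops \<Longrightarrow> B \<in> bounded_ops \<Longrightarrow> adj (A - B) = adj A - adj B"
  "A \<in> bounded_ops \<Longrightarrow> adj (- A) = - adj A"
  "A \<in> bounded_ops \<Longrightarrow> adj (r *\<^sub>R A) = r *\<^sub>R adj A"
  "A \<in> bounded_ops \<Longrightarrow> B \<in> bounded_ops \<Longrightarrow> adj (A o\<^sub>L B) = adj B o\<^sub>L adj A"
  by (rule adj_eqI; simp add: blinfun.bilinear_simps inner_simps inner_adj inner_scaleC_cnj)+

lemma adj_adj [simp]: "A \<in> bounded_ops \<Longrightarrow> adj (adj A) = A"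
  by (rule adj_eqI) (auto simp: inner_adj')

section \<open>Invertible operators\<close>

definition invertible_op :: "('a::chilbert_space) op \<Rightarrow> bool" where
  "invertible_op A \<longleftrightarrow> (\<exists>B\<in>bounded_ops. B o\<^sub>L A = id_blinfun \<and> A o\<^sub>L B = id_blinfun)"

lemma spectrum_iff: "c \<in> spectrum A \<longleftrightarrow> \<not> invertible_op (A - scalar_op c)"
  by (simp add: spectrum_def invertible_op_def)

text \<open>Lax--Milgram: \<open>Sx = y\<close> is the fixed point equation of the contraction
  \<open>x \<mapsto> x - t(Sx - y)\<close> for small \<open>t > 0\<close>.\<close>

lemma coercive_invertible:
  fixes S :: "('a::chilbert_space) op"
  assumes S: "S \<in> bounded_ops" and e: "0 < e"
    and coer: "\<And>x. e * (norm x)\<^sup>2 \<le> inner x (blinfun_apply S x)"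
  shows "invertible_op S"
proof -
  \<comment> \<open>\<open>K\<close> bounds \<open>norm S\<close> and is at least \<open>e\<close>,
    so the root in \<open>c\<close> is real. The choice \<open>t = e / K^2\<close> minimises the
    contraction bound \<open>1 - 2 t e + t^2 K^2\<close>, whose minimum is
    \<open>c^2\<close>.\<close>
  define K where "K = norm S + e"
  have K: "0 < K" "e \<le> K" "norm S \<le> K" using e by (auto simp: K_def add_nonneg_pos)
  define t where "t = e / K\<^sup>2"
  define c where "c = sqrt (1 - e\<^sup>2 / K\<^sup>2)"
  have eK: "e\<^sup>2 / K\<^sup>2 \<le> 1" "0 < e\<^sup>2 / K\<^sup>2" using e K by (auto simp: power_mono)
  have c: "0 \<le> c" "c < 1" using eK by (auto simp: c_def)
  have contr: "norm (x - t *\<^sub>R S x) \<le> c * norm x" for x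
  proof (rule power2_le_imp_le)
    have Sx: "inner (S x) (S x) \<le> K\<^sup>2 * (norm x)\<^sup>2"
    proof -
      have "norm (S x) \<le> K * norm x"
        using norm_blinfun[of S x] K by (meson mult_right_mono norm_ge_zero order_trans)
      then have "(norm (S x))\<^sup>2 \<le> (K * norm x)\<^sup>2" by (intro power_mono) auto
      then show ?thesis by (simp add: power2_norm_eq_inner power_mult_distrib)
    qed
    have t0: "0 < t" using e K by (simp add: t_def)
    have "(norm (x - t *\<^sub>R S x))\<^sup>2 = (norm x)\<^sup>2 - 2 * t * inner x (S x) + t\<^sup>2 * inner (S x) (S x)"
      unfolding power2_norm_eq_inner by (simp add: algebra_simps inner_commute power2_eq_square)
    also have "\<dots> \<le> (norm x)\<^sup>2 - 2 * t * (e * (norm x)\<^sup>2) + t\<^sup>2 * (K\<^sup>2 * (norm x)\<^sup>2)"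
      using t0 by (intro add_mono diff_mono mult_left_mono coer Sx) auto
    also have "\<dots> = (1 - e\<^sup>2 / K\<^sup>2) * (norm x)\<^sup>2"
      using K by (simp add: t_def field_simps power2_eq_square)
    also have "\<dots> = (c * norm x)\<^sup>2" using eK by (simp add: c_def power_mult_distrib)
    finally show "(norm (x - t *\<^sub>R S x))\<^sup>2 \<le> (c * norm x)\<^sup>2" .
  qed (use c in auto)
  have t0: "t \<noteq> 0" using e K by (simp add: t_def)
  have "\<exists>!x. S x = y" for y
  proof -
    define F where "F x = x - t *\<^sub>R (S x - y)" for x
    have "dist (F u) (F v) \<le> c * dist u v" for u v
      using contr[of "u - v"] by (simp add: F_def dist_norm blinfun.bilinear_simps algebra_simps)
    then have "\<exists>!x. F x = x" using c by (intro banach_fix_type) auto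
    moreover have "F x = x \<longleftrightarrow> S x = y" for x using t0 by (simp add: F_def)
    ultimately show ?thesis by simp
  qed
  then obtain g where g: "\<And>y. S (g y) = y" and g': "\<And>x. g (S x) = x" by metis
  have "bounded_linear g"
  proof (rule bounded_linear_intro[where K = "1 / e"])
    fix x y show "g (x + y) = g x + g y" by (metis blinfun.add_right g g')
  next
    fix r x show "g (r *\<^sub>R x) = r *\<^sub>R g x" by (metis blinfun.scaleR_right g g')
  next
    fix y
    have "e * (norm (g y))\<^sup>2 \<le> inner (g y) y" using coer[of "g y"] by (simp add: g)
    also have "\<dots> \<le> norm (g y) * norm y" by (rule norm_cauchy_schwarz)
    finally have "norm (g y) * (e * norm (g y)) \<le> norm (g y) * norm y"
      by (simp add: power2_eq_square mult_ac)
    then have "e * norm (g y) \<le> norm y"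
      by (cases "norm (g y) = 0") auto
    then show "norm (g y) \<le> norm y * (1 / e)" using e by (simp add: field_simps)
  qed
  then have app: "blinfun_apply (Blinfun g) = g" by (rule bounded_linear_Blinfun_apply)
  show ?thesis unfolding invertible_op_def
  proof (intro bexI conjI)
    show "Blinfun g \<in> bounded_ops"
      by (rule bounded_opsI) (metis app S bounded_ops_scaleC g g')
  qed (auto intro!: blinfun_eqI simp: app g g')
qed

subsection \<open>Spectrum of self-adjoint operators\<close>

lemma scalar_op_commute: "A \<in> bounded_ops \<Longrightarrow> scalar_op c o\<^sub>L A = A o\<^sub>L scalar_op c"
  by (rule blinfun_eqI) (simp add: bounded_ops_scaleC)

lemma scalar_op_of_real: "scalar_op (complex_of_real r) = r *\<^sub>R id_blinfun"
  by (rule blinfun_eqI) (simp add: scaleR_scaleC blinfun.scaleR_left)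

lemma compose_id [simp]: "id_blinfun o\<^sub>L A = A" "A o\<^sub>L id_blinfun = A"
  by (auto intro: blinfun_eqI)

lemma compose_assoc: "(A o\<^sub>L B) o\<^sub>L C = A o\<^sub>L (B o\<^sub>L C)"
  by (auto intro: blinfun_eqI)

lemmas compose_simps =
  bounded_bilinear.add_left[OF bounded_bilinear_blinfun_compose]
  bounded_bilinear.add_right[OF bounded_bilinear_blinfun_compose]
  bounded_bilinear.diff_left[OF bounded_bilinear_blinfun_compose]
  bounded_bilinear.diff_right[OF bounded_bilinear_blinfun_compose]
  bounded_bilinear.minus_left[OF bounded_bilinear_blinfun_compose]
  bounded_bilinear.minus_right[OF bounded_bilinear_blinfun_compose]
  bounded_bilinear.scaleR_left[OF bounded_bilinear_blinfun_compose]
  bounded_bilinear.scaleR_right[OF bounded_bilinear_blinfun_compose]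

lemma invertible_op_compose:
  assumes "invertible_op A" "invertible_op B"
  shows "invertible_op (A o\<^sub>L B)"
proof -
  obtain A' B' where "A' \<in> bounded_ops" "B' \<in> bounded_ops"
    and A': "A' o\<^sub>L A = id_blinfun" "A o\<^sub>L A' = id_blinfun"
    and B': "B' o\<^sub>L B = id_blinfun" "B o\<^sub>L B' = id_blinfun"
    using assms by (auto simp: invertible_op_def)
  moreover have "(B' o\<^sub>L A') o\<^sub>L (A o\<^sub>L B) = id_blinfun"
    by (metis compose_assoc compose_id(1) A'(1) B'(1))
  moreover have "(A o\<^sub>L B) o\<^sub>L (B' o\<^sub>L A') = id_blinfun"
    by (metis compose_assoc compose_id(1) A'(2) B'(2))
  ultimately show ?thesis unfolding invertible_op_def by blast
qed

text \<open>If \<open>X\<close> inverts the product, then \<open>B X\<close> is a right and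
  \<open>X B\<close> a left inverse of \<open>A\<close>, and the two agree.\<close>

lemma invertible_op_factor:
  assumes "A \<in> bounded_ops" "B \<in> bounded_ops" "A o\<^sub>L B = B o\<^sub>L A" "invertible_op (A o\<^sub>L B)"
  shows "invertible_op A"
proof -
  obtain X where X: "X \<in> bounded_ops" "X o\<^sub>L (A o\<^sub>L B) = id_blinfun" "(A o\<^sub>L B) o\<^sub>L X = id_blinfun"
    using assms(4) by (auto simp: invertible_op_def)
  have 1: "A o\<^sub>L (B o\<^sub>L X) = id_blinfun" using X(3) by (simp add: compose_assoc)
  have 2: "(X o\<^sub>L B) o\<^sub>L A = id_blinfun" using X(2) by (simp add: compose_assoc assms(3))
  have "X o\<^sub>L B = B o\<^sub>L X" by (metis 1 2 compose_assoc compose_id)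
  then show ?thesis using 1 2 X(1) assms(2) unfolding invertible_op_def by auto
qed

definition selfadj :: "('a::chilbert_space) op \<Rightarrow> bool" where
  "selfadj A \<longleftrightarrow> A \<in> bounded_ops \<and> adj A = A"

lemma selfadj_bounded_ops [dest]: "selfadj A \<Longrightarrow> A \<in> bounded_ops"
  by (simp add: selfadj_def)

lemma selfadj_inner:
  "selfadj A \<Longrightarrow> inner (blinfun_apply A x) y = inner x (blinfun_apply A y)"
  by (metis inner_adj selfadj_def)

lemma selfadjI:
  "A \<in> bounded_ops \<Longrightarrow> (\<And>x y. inner (blinfun_apply A x) y = inner x (blinfun_apply A y)) \<Longrightarrow> selfadj A"
  by (simp add: selfadj_def adj_eqI)

lemma selfadj_closed [simp, intro]:
  "selfadj id_blinfun" "selfadj 0"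
  "selfadj A \<Longrightarrow> selfadj B \<Longrightarrow> selfadj (A + B)"
  "selfadj A \<Longrightarrow> selfadj B \<Longrightarrow> selfadj (A - B)"
  "selfadj A \<Longrightarrow> selfadj (r *\<^sub>R A)"
  by (auto intro!: selfadjI simp: selfadj_inner blinfun.bilinear_simps inner_simps)

lemma selfadj_compose: "selfadj A \<Longrightarrow> selfadj B \<Longrightarrow> A o\<^sub>L B = B o\<^sub>L A \<Longrightarrow> selfadj (A o\<^sub>L B)"
  by (simp add: selfadj_def)

lemma selfadj_Im_cinner:
  assumes "selfadj A"
  shows "Im (cinner x (blinfun_apply A x)) = 0"
proof -
  have "- Im (cinner x (A x)) = inner x (A (\<i> *\<^sub>C x))"
    using assms by (simp add: bounded_ops_scaleC selfadj_bounded_ops inner_scaleC_ii)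
  also have "\<dots> = - Im (cinner (A x) x)"
    using assms by (simp add: inner_scaleC_ii flip: selfadj_inner)
  also have "\<dots> = Im (cinner x (A x))"
    by (subst cinner_commute) simp
  finally show ?thesis by simp
qed

text \<open>The quadratic form of \<open>A\<close> is real, so the imaginary part of the form of
  \<open>A - c\<close> is \<open>- Im c\<close> times the squared norm. If it is nonzero, a rotation
  by a right angle makes the operator coercive, hence invertible.\<close>

lemma spectrum_selfadj_real:
  assumes A: "selfadj A" and c: "c \<in> spectrum A"
  shows "c = complex_of_real (Re c)"
proof (rule ccontr)
  assume "c \<noteq> complex_of_real (Re c)"
  then have Imc: "Im c \<noteq> 0" by (auto simp: complex_eq_iff)
  define T where "T = A - scalar_op c"
  \<comment> \<open>The sign makes the rotated real form equal to \<open>\<bar>Im c\<bar>\<close>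
    times the squared norm, whichever half plane contains \<open>c\<close>.\<close>
  define d where "d = \<i> * complex_of_real (sgn (Im c))"
  have T: "T \<in> bounded_ops" using A by (auto simp: T_def)
  have "inner x (d *\<^sub>C T x) = \<bar>Im c\<bar> * (norm x)\<^sup>2" for x
  proof -
    have "Im (cinner x (T x)) = inner (\<i> *\<^sub>C x) (A x - c *\<^sub>C x)"
      by (simp add: inner_scaleC_ii T_def blinfun.diff_left)
    also have "\<dots> = - Im (c * cinner x x)"
      by (simp add: inner_diff_right inner_scaleC_ii selfadj_Im_cinner[OF A] cinner_scaleC_right)
    also have "\<dots> = - Im c * (norm x)\<^sup>2"
      using selfadj_Im_cinner[of id_blinfun x]
      by (simp add: power2_norm_eq_inner inner_Re_cinner)
    finally have "Im (cinner x (T x)) = - Im c * (norm x)\<^sup>2" .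
    then show ?thesis
      by (simp add: d_def inner_Re_cinner cinner_scaleC_right abs_sgn mult_ac)
  qed
  then have "invertible_op (scalar_op d o\<^sub>L T)"
    using T Imc by (intro coercive_invertible[where e = "\<bar>Im c\<bar>"]) auto
  then have "invertible_op T"
    using T by (intro invertible_op_factor[of T "scalar_op d"]) (auto simp: scalar_op_commute)
  then show False using c by (simp add: spectrum_iff T_def)
qed

definition real_spectrum :: "('a::chilbert_space) op \<Rightarrow> real set" where
  "real_spectrum A = {t. complex_of_real t \<in> spectrum A}"

lemma real_spectrum_iff: "t \<in> real_spectrum A \<longleftrightarrow> \<not> invertible_op (A - t *\<^sub>R id_blinfun)"
  by (simp add: real_spectrum_def spectrum_iff scalar_op_of_real)

lemma invertible_op_minus: "invertible_op (- A) \<longleftrightarrow> invertible_op A"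
proof -
  have "invertible_op A \<Longrightarrow> invertible_op (- A)" for A :: "'a op"
    unfolding invertible_op_def by (metis bounded_ops_closed(6) compose_simps(5,6) minus_minus)
  from this[of A] this[of "- A"] show ?thesis by auto
qed

text \<open>Below \<open>a\<close> the operator \<open>A - t\<close> is coercive with constant
  \<open>a - t\<close>; above \<open>b\<close> its negative is coercive with constant
  \<open>t - b\<close>.\<close>

lemma real_spectrum_bounds:
  assumes A: "A \<in> bounded_ops"
    and lower: "\<And>x. a * (norm x)\<^sup>2 \<le> inner x (blinfun_apply A x)"
    and upper: "\<And>x. inner x (blinfun_apply A x) \<le> b * (norm x)\<^sup>2"
  shows "real_spectrum A \<subseteq> {a..b}"
proof
  fix t assume "t \<in> real_spectrum A"
  then have ni: "\<not> invertible_op (A - t *\<^sub>R id_blinfun)" by (simp add: real_spectrum_iff)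
  have "\<not> t < a"
  proof
    assume "t < a"
    then have "invertible_op (A - t *\<^sub>R id_blinfun)"
      using lower A by (intro coercive_invertible[where e = "a - t"])
        (auto simp: blinfun.bilinear_simps inner_simps power2_norm_eq_inner algebra_simps)
    with ni show False ..
  qed
  moreover have "\<not> b < t"
  proof
    assume "b < t"
    then have "invertible_op (- (A - t *\<^sub>R id_blinfun))"
      using upper A by (intro coercive_invertible[where e = "t - b"])
        (auto simp: blinfun.bilinear_simps inner_simps power2_norm_eq_inner algebra_simps)
    with ni show False unfolding invertible_op_minus ..
  qed
  ultimately show "t \<in> {a..b}" by auto
qed

text \<open>Otherwise \<open>B\<^sup>2 - \<parallel>B\<parallel>\<^sup>2\<close> would be invertible, but it is small on vectors on which \<open>B\<close> almost
  attains its norm.\<close>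

lemma norm_selfadj_le:
  assumes B: "selfadj B" and M: "0 \<le> M" and spec: "\<And>t. t \<in> real_spectrum B \<Longrightarrow> \<bar>t\<bar> \<le> M"
  shows "norm B \<le> M"
proof (rule ccontr)
  assume "\<not> norm B \<le> M"
  define K where "K = norm B"
  have K: "0 < K" using M \<open>\<not> norm B \<le> M\<close> unfolding K_def by linarith
  have "K \<notin> real_spectrum B" "- K \<notin> real_spectrum B"
    using spec[of K] spec[of "- K"] \<open>\<not> norm B \<le> M\<close> by (auto simp: K_def)
  then have "invertible_op ((B - K *\<^sub>R id_blinfun) o\<^sub>L (B - (- K) *\<^sub>R id_blinfun))"
    by (intro invertible_op_compose) (auto simp only: real_spectrum_iff not_not)
  then obtain R where R: "R o\<^sub>L ((B - K *\<^sub>R id_blinfun) o\<^sub>L (B - (- K) *\<^sub>R id_blinfun)) = id_blinfun"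
    unfolding invertible_op_def by blast
  define r where "r = norm R + 1"
  have r: "0 < r" by (simp add: r_def add_nonneg_pos)
  have key: "(norm x)\<^sup>2 \<le> r\<^sup>2 * (K\<^sup>2 * (K\<^sup>2 * (norm x)\<^sup>2 - (norm (B x))\<^sup>2))" for x
  proof -
    define y where "y = B (B x) - K\<^sup>2 *\<^sub>R x"
    have "x = R y"
      using arg_cong[OF R, of "\<lambda>T. blinfun_apply T x"]
      by (simp add: y_def blinfun.bilinear_simps algebra_simps power2_eq_square)
    then have "norm x \<le> r * norm y"
      using norm_blinfun[of R y] unfolding r_def distrib_right by (simp add: add_increasing2)
    then have "(norm x)\<^sup>2 \<le> (r * norm y)\<^sup>2" by (intro power_mono) auto
    also have "\<dots> = r\<^sup>2 * (norm y)\<^sup>2" by (simp add: power_mult_distrib)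
    also have "(norm y)\<^sup>2 = (norm (B (B x)))\<^sup>2 - 2 * K\<^sup>2 * (norm (B x))\<^sup>2 + K\<^sup>2 * K\<^sup>2 * (norm x)\<^sup>2"
      unfolding power2_norm_eq_inner y_def
      by (simp add: selfadj_inner[OF B] algebra_simps inner_commute)
    also have "(norm (B (B x)))\<^sup>2 \<le> K\<^sup>2 * (norm (B x))\<^sup>2"
      using norm_blinfun[of B "B x"] by (metis K_def norm_ge_zero power_mono power_mult_distrib)
    finally show ?thesis using r by (simp add: algebra_simps)
  qed
  \<comment> \<open>Solving \<open>key\<close> for \<open>norm (B x)^2\<close> produces this factor.
    It is strictly smaller than \<open>K^2\<close>, which contradicts \<open>K = norm B\<close>;
    \<open>max 0 b\<close> merely keeps the root in the nonnegative range.\<close>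
  define b where "b = K\<^sup>2 - 1 / (r\<^sup>2 * K\<^sup>2)"
  have Bx: "(norm (B x))\<^sup>2 \<le> b * (norm x)\<^sup>2" for x
    using key[of x] K r by (simp add: b_def field_simps)
  have "norm B \<le> sqrt (max 0 b)"
  proof (rule norm_blinfun_bound)
    fix x
    have "(norm (B x))\<^sup>2 \<le> max 0 b * (norm x)\<^sup>2"
      by (rule order_trans[OF Bx]) (auto intro: mult_right_mono)
    then have "sqrt ((norm (B x))\<^sup>2) \<le> sqrt (max 0 b * (norm x)\<^sup>2)" by (rule real_sqrt_le_mono)
    then show "norm (B x) \<le> sqrt (max 0 b) * norm x" by (simp add: real_sqrt_mult)
  qed simp
  also have "\<dots> < sqrt (K\<^sup>2)"
    using K r by (intro real_sqrt_less_mono) (auto simp: b_def)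
  finally show False using K by (simp add: K_def)
qed

text \<open>An empty spectrum would give \<open>norm A = 0\<close>, and then \<open>0\<close>, not
  being a spectral value, would make the zero operator invertible. On the zero space this does
  happen, whence the second assumption.\<close>

lemma real_spectrum_nonempty:
  assumes "selfadj A" "(id_blinfun :: ('a::chilbert_space) op) \<noteq> 0"
  shows "real_spectrum (A :: 'a op) \<noteq> {}"
proof
  assume empty: "real_spectrum A = {}"
  then have "norm A \<le> 0" by (intro norm_selfadj_le[OF assms(1)]) auto
  then have "invertible_op (0 :: 'a op)"
    using empty real_spectrum_iff[of 0 A] by simp
  then show False using assms(2) by (auto simp: invertible_op_def)
qed

section \<open>Polynomials of operators and spectral mapping\<close>

definition cop_poly :: "complex poly \<Rightarrow> ('a::chilbert_space) op \<Rightarrow> 'a op" where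
  "cop_poly q A = fold_coeffs (\<lambda>a B. scalar_op a + (A o\<^sub>L B)) q 0"

lemma scalar_op_0 [simp]: "scalar_op 0 = 0"
  by (rule blinfun_eqI) simp

lemma cop_poly_0 [simp]: "cop_poly 0 A = 0"
  by (simp add: cop_poly_def)

lemma cop_poly_pCons: "cop_poly (pCons a q) A = scalar_op a + (A o\<^sub>L cop_poly q A)"
  by (cases "q = 0 \<and> a = 0") (auto simp: cop_poly_def)

lemma scalar_op_add: "scalar_op (a + b) = scalar_op a + scalar_op b"
  by (rule blinfun_eqI) (simp add: scaleC_add_left blinfun.add_left)

lemma scalar_op_minus: "scalar_op (- a) = - scalar_op a"
  by (metis add.inverse_unique right_minus scalar_op_0 scalar_op_add)

lemma scalar_op_mult: "scalar_op (a * b) = scalar_op a o\<^sub>L scalar_op b"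
  by (rule blinfun_eqI) (simp add: scaleC_scaleC)

lemma cop_poly_add: "cop_poly (p + q) A = cop_poly p A + cop_poly q A"
  by (induction p q rule: poly_induct2) (simp_all add: cop_poly_pCons scalar_op_add compose_simps)

lemma cop_poly_smult:
  assumes "A \<in> bounded_ops"
  shows "cop_poly (smult c q) A = scalar_op c o\<^sub>L cop_poly q A"
proof (induction q)
  case (pCons a q)
  have "A o\<^sub>L (scalar_op c o\<^sub>L cop_poly q A) = scalar_op c o\<^sub>L (A o\<^sub>L cop_poly q A)"
    by (metis assms compose_assoc scalar_op_commute)
  with pCons show ?case by (simp add: cop_poly_pCons scalar_op_mult compose_simps)
qed simp

lemma invertible_scalar_op: "c \<noteq> 0 \<Longrightarrow> invertible_op (scalar_op c)"
  unfolding invertible_op_def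
  by (intro bexI[of _ "scalar_op (inverse c)"]) (auto intro!: blinfun_eqI simp: scaleC_scaleC)

text \<open>Over the complex numbers the polynomial splits, and each linear factor is invertible
  because its root avoids the spectrum. Real polynomials are embedded through
  \<open>cop_poly\<close> in order to use this splitting.\<close>

lemma invertible_cop_poly:
  assumes A: "A \<in> bounded_ops"
  shows "q \<noteq> 0 \<Longrightarrow> (\<And>z. poly q z = 0 \<Longrightarrow> z \<notin> spectrum A) \<Longrightarrow> invertible_op (cop_poly q A)"
proof (induction "degree q" arbitrary: q rule: less_induct)
  case less
  show ?case
  proof (cases "constant (poly q)")
    case True
    then obtain c where "q = [:c:]" by (metis constant_degree degree_eq_zeroE)
    with less.prems(1) show ?thesis by (simp add: cop_poly_pCons invertible_scalar_op)
  next
    case False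
    then obtain z where z: "poly q z = 0" using fundamental_theorem_of_algebra by blast
    then obtain r where q: "q = [:-z, 1:] * r" by (auto simp: poly_eq_0_iff_dvd dvd_def)
    with less.prems(1) have r: "r \<noteq> 0" by auto
    have "degree q = Suc (degree r)" using r unfolding q by (subst degree_mult_eq) auto
    then have "invertible_op (cop_poly r A)"
      using r less.prems(2) by (intro less.hyps) (auto simp: q)
    moreover have "invertible_op (A - scalar_op z)"
      using less.prems(2)[OF z] by (simp add: spectrum_iff)
    moreover have "cop_poly q A = (A - scalar_op z) o\<^sub>L cop_poly r A"
    proof -
      have "q = smult (- z) r + pCons 0 r" by (simp add: q)
      then show ?thesis
        unfolding \<open>q = smult (- z) r + pCons 0 r\<close> cop_poly_add cop_poly_smult[OF A] cop_poly_pCons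
        by (simp add: compose_simps scalar_op_minus)
    qed
    ultimately show ?thesis by (simp add: invertible_op_compose)
  qed
qed

lemma op_poly_0 [simp]: "op_poly 0 A = 0"
  by (simp add: op_poly_def)

text \<open>This Horner recursion replaces the explicit power sum in \<open>op_poly\<close> and
  opens the way to induction on the polynomial.\<close>

lemma op_poly_pCons: "op_poly (pCons a q) A = a *\<^sub>R id_blinfun + (A o\<^sub>L op_poly q A)"
proof (cases "q = 0")
  case True
  then show ?thesis by (simp add: op_poly_def)
next
  case False
  then show ?thesis
    by (simp add: op_poly_def sum.atMost_Suc_shift compose_simps
        bounded_bilinear.sum_right[OF bounded_bilinear_blinfun_compose] del: sum.atMost_Suc)
qed

lemma cop_poly_of_real: "cop_poly (map_poly complex_of_real q) A = op_poly q A"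
  by (induction q) (simp_all add: cop_poly_pCons op_poly_pCons map_poly_pCons scalar_op_of_real)

lemma poly_of_real:
  "poly (map_poly complex_of_real q) (complex_of_real s) = complex_of_real (poly q s)"
  by (induction q) (simp_all add: map_poly_pCons)

lemma op_poly_add: "op_poly (p + q) A = op_poly p A + op_poly q A"
  by (induction p q rule: poly_induct2) (simp_all add: op_poly_pCons algebra_simps compose_simps)

lemma op_poly_smult: "op_poly (smult c q) A = c *\<^sub>R op_poly q A"
  by (induction q) (simp_all add: op_poly_pCons algebra_simps compose_simps)

lemma op_poly_diff: "op_poly (p - q) A = op_poly p A - op_poly q A"
  using op_poly_add[of p "smult (-1) q" A] op_poly_smult[of "-1" q A] by simp

lemma op_poly_mult: "op_poly (p * q) A = op_poly p A o\<^sub>L op_poly q A"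
  by (induction p) (simp_all add: op_poly_pCons op_poly_add op_poly_smult compose_simps compose_assoc)

lemma op_poly_commute:
  "C o\<^sub>L A = A o\<^sub>L C \<Longrightarrow> C o\<^sub>L op_poly q A = op_poly q A o\<^sub>L C"
  by (induction q) (simp_all add: op_poly_pCons compose_simps, metis compose_assoc)

lemma op_poly_bounded_ops [simp, intro]: "A \<in> bounded_ops \<Longrightarrow> op_poly q A \<in> bounded_ops"
  by (induction q) (auto simp: op_poly_pCons)

lemma op_poly_selfadj:
  assumes "selfadj A" shows "selfadj (op_poly q A)"
proof (induction q)
  case (pCons a q)
  then show ?case
    using assms op_poly_commute[of A A q]
    by (auto simp: op_poly_pCons intro!: selfadj_closed selfadj_compose)
qed simp

text \<open>The spectral mapping theorem puts the spectrum of \<open>q(A)\<close> inside the image of that of \<open>A\<close>.\<close>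

lemma norm_op_poly_le:
  assumes A: "selfadj A" and M: "0 \<le> M"
    and bound: "\<And>t. t \<in> real_spectrum A \<Longrightarrow> \<bar>poly q t\<bar> \<le> M"
  shows "norm (op_poly q A) \<le> M"
proof (rule norm_selfadj_le[OF op_poly_selfadj[OF A] M])
  fix t assume "t \<in> real_spectrum (op_poly q A)"
  then have ni: "\<not> invertible_op (op_poly (q - [:t:]) A)"
    by (simp add: real_spectrum_iff op_poly_diff op_poly_pCons)
  have "\<exists>s\<in>real_spectrum A. poly (q - [:t:]) s = 0"
  proof (cases "q - [:t:] = 0")
    \<comment> \<open>Here \<open>q\<close> is the constant \<open>t\<close>, every real number is a
      root, and any spectral point will do. The space is nonzero, as otherwise the zero operator
      would be invertible.\<close>
    case True
    have "(id_blinfun :: 'a op) \<noteq> 0"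
    proof
      assume "(id_blinfun :: 'a op) = 0"
      then have "invertible_op (0 :: 'a op)" by (auto simp: invertible_op_def)
      with ni True show False by simp
    qed
    then show ?thesis using real_spectrum_nonempty[OF A] True by auto
  next
    case False
    then have "map_poly complex_of_real (q - [:t:]) \<noteq> 0"
      by (simp add: map_poly_eq_0_iff)
    \<comment> \<open>Were all complex roots of \<open>q - t\<close> outside the spectrum of
      \<open>A\<close>, the operator \<open>q(A) - t\<close> would be invertible. The root found in
      the spectrum is real since \<open>A\<close> is self-adjoint.\<close>
    then obtain z where z: "poly (map_poly complex_of_real (q - [:t:])) z = 0" "z \<in> spectrum A"
      using invertible_cop_poly[of A "map_poly complex_of_real (q - [:t:])"] A ni
      by (auto simp: cop_poly_of_real)
    obtain s where s: "z = complex_of_real s" using spectrum_selfadj_real[OF A z(2)] by metis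
    then have "poly (q - [:t:]) s = 0" using z(1) poly_of_real[of "q - [:t:]" s] by simp
    then show ?thesis using z(2) s by (auto simp: real_spectrum_def)
  qed
  then show "\<bar>t\<bar> \<le> M" using bound by auto
qed

subsection \<open>Continuous functional calculus\<close>

lemma poly_uniform_approx:
  fixes f :: "real \<Rightarrow> real"
  assumes "continuous_on {a..b} f"
  shows "\<exists>q. uniform_limit {a..b} (\<lambda>n. poly (q n)) f sequentially"
proof -
  have ex: "\<exists>q. \<forall>x\<in>{a..b}. \<bar>f x - poly q x\<bar> < e" if e: "e > 0" for e
  proof -
    obtain g where g: "real_polynomial_function g" "\<And>x. x \<in> {a..b} \<Longrightarrow> \<bar>f x - g x\<bar> < e"
      using Stone_Weierstrass_real_polynomial_function[OF compact_Icc assms e] by blast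
    then obtain c n where "g = (\<lambda>x. \<Sum>i\<le>n. c i * x ^ i)"
      by (auto simp: real_polynomial_function_iff_sum)
    then have "g = poly (\<Sum>i\<le>n. monom (c i) i)" by (simp add: fun_eq_iff poly_sum poly_monom)
    with g(2) show ?thesis by blast
  qed
  have "\<exists>q. \<forall>x\<in>{a..b}. \<bar>f x - poly q x\<bar> < inverse (real (Suc n))" for n
    by (rule ex) simp
  then obtain q where q: "\<And>n x. x \<in> {a..b} \<Longrightarrow> \<bar>f x - poly (q n) x\<bar> < inverse (real (Suc n))"
    by metis
  have "uniform_limit {a..b} (\<lambda>n. poly (q n)) f sequentially"
  proof (rule uniform_limitI)
    fix e :: real assume "0 < e"
    then have "\<forall>\<^sub>F n in sequentially. inverse (real (Suc n)) < e"
      using LIMSEQ_inverse_real_of_nat by (intro order_tendstoD)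
    then show "\<forall>\<^sub>F n in sequentially. \<forall>x\<in>{a..b}. dist (poly (q n) x) (f x) < e"
      by eventually_elim (use q in \<open>force simp: dist_real_def abs_minus_commute simp del: of_nat_Suc
        intro: less_trans\<close>)
  qed
  then show ?thesis by blast
qed

lemma poly_add_fun: "poly (p + q) = (\<lambda>t. poly p t + poly q t)"
  and poly_mult_fun: "poly (p * q) = (\<lambda>t. poly p t * poly q t)"
  for p q :: "real poly"
  by (simp_all add: fun_eq_iff)

text \<open>Resolves the definite description in \<open>cfc\<close>: two polynomial sequences with
  the same uniform limit on the spectrum differ by polynomials tending to 0 there, and
  \<open>norm_op_poly_le\<close> carries this over to the operators.\<close>

lemma cfc_eqI:
  assumes A: "selfadj A"
    and q: "uniform_limit (real_spectrum A) (\<lambda>n. poly (q n)) f sequentially"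
    and B: "(\<lambda>n. op_poly (q n) A) \<longlonglongrightarrow> B"
  shows "cfc f A = B"
  unfolding cfc_def real_spectrum_def[symmetric]
proof (rule the_equality)
  show "\<exists>q. uniform_limit (real_spectrum A) (\<lambda>n. poly (q n)) f sequentially
      \<and> (\<lambda>n. op_poly (q n) A) \<longlonglongrightarrow> B"
    using q B by blast
next
  fix C
  assume "\<exists>q. uniform_limit (real_spectrum A) (\<lambda>n. poly (q n)) f sequentially
      \<and> (\<lambda>n. op_poly (q n) A) \<longlonglongrightarrow> C"
  then obtain r where r: "uniform_limit (real_spectrum A) (\<lambda>n. poly (r n)) f sequentially"
    and C: "(\<lambda>n. op_poly (r n) A) \<longlonglongrightarrow> C" by blast
  have "(\<lambda>n. op_poly (r n) A - op_poly (q n) A) \<longlonglongrightarrow> 0"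
  proof (rule tendstoI)
    fix e :: real assume "0 < e"
    with uniform_limitD[OF uniform_limit_minus[OF r q], of "e / 2"]
    have "\<forall>\<^sub>F n in sequentially. \<forall>t\<in>real_spectrum A. \<bar>poly (r n - q n) t\<bar> < e / 2" by simp
    then show "\<forall>\<^sub>F n in sequentially. dist (op_poly (r n) A - op_poly (q n) A) 0 < e"
    proof eventually_elim
      case (elim n)
      have "norm (op_poly (r n - q n) A) \<le> e / 2"
        using \<open>0 < e\<close> elim by (intro norm_op_poly_le[OF A]) (auto intro: less_imp_le)
      then show ?case using \<open>0 < e\<close> by (simp add: op_poly_diff)
    qed
  qed
  then have "C - B = 0" using tendsto_diff[OF C B] LIMSEQ_unique by blast
  then show "C = B" by simp
qed

lemma cfc_cong: "(\<And>t. t \<in> real_spectrum A \<Longrightarrow> f t = g t) \<Longrightarrow> cfc f A = cfc g A"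
  unfolding cfc_def real_spectrum_def[symmetric] by (simp cong: uniform_limit_cong')

lemma cfc_poly: "selfadj A \<Longrightarrow> cfc (poly q) A = op_poly q A"
  by (rule cfc_eqI[where q = "\<lambda>_. q"]) (auto intro: uniform_limit_const)

lemma cfc_const: "selfadj A \<Longrightarrow> cfc (\<lambda>_. c) A = c *\<^sub>R id_blinfun"
proof -
  assume "selfadj A"
  moreover have "poly [:c:] = (\<lambda>_. c)" by (simp add: fun_eq_iff)
  ultimately show ?thesis using cfc_poly[of A "[:c:]"] by (simp add: op_poly_pCons)
qed

lemma bounded_ops_limit:
  assumes "\<And>n. T n \<in> bounded_ops" "T \<longlonglongrightarrow> B"
  shows "B \<in> bounded_ops"
proof (rule bounded_opsI)
  fix c x
  have "(\<lambda>n. T n (c *\<^sub>C x)) \<longlonglongrightarrow> B (c *\<^sub>C x)"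
    by (intro blinfun.tendsto assms(2) tendsto_const)
  moreover have "(\<lambda>n. T n (c *\<^sub>C x)) \<longlonglongrightarrow> c *\<^sub>C B x"
    unfolding bounded_ops_scaleC[OF assms(1)]
    by (intro bounded_linear.tendsto[OF bounded_linear_scaleC] blinfun.tendsto assms(2) tendsto_const)
  ultimately show "B (c *\<^sub>C x) = c *\<^sub>C B x" by (rule LIMSEQ_unique)
qed

lemma selfadj_limit:
  assumes "\<And>n. selfadj (T n)" "T \<longlonglongrightarrow> B"
  shows "selfadj B"
proof (rule selfadjI)
  show "B \<in> bounded_ops" using assms by (auto intro: bounded_ops_limit)
  fix x y
  have "(\<lambda>n. inner (T n x) y) \<longlonglongrightarrow> inner (B x) y"
    by (intro tendsto_intros blinfun.tendsto assms(2))
  moreover have "(\<lambda>n. inner (T n x) y) \<longlonglongrightarrow> inner x (B y)"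
    unfolding selfadj_inner[OF assms(1)] by (intro tendsto_intros blinfun.tendsto assms(2))
  ultimately show "inner (B x) y = inner x (B y)" by (rule LIMSEQ_unique)
qed

section \<open>Functional calculus on an interval containing the spectrum\<close>

context
  fixes A :: "('a::chilbert_space) op" and a b :: real
  assumes A: "selfadj A" and spec: "real_spectrum A \<subseteq> {a..b}"
begin

text \<open>By \<open>norm_op_poly_le\<close> the uniformly Cauchy polynomials give a Cauchy
  sequence of operators; completeness provides a limit and \<open>cfc_eqI\<close> identifies
  it.\<close>

lemma cfc_tendsto:
  assumes q: "uniform_limit {a..b} (\<lambda>n. poly (q n)) f sequentially"
  shows "(\<lambda>n. op_poly (q n) A) \<longlonglongrightarrow> cfc f A"
proof -
  have "Cauchy (\<lambda>n. op_poly (q n) A)"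
  proof (rule metric_CauchyI)
    fix e :: real assume "0 < e"
    then have "0 < e / 4" by simp
    from uniform_limitD[OF q this] obtain M
      where M: "\<And>n t. n \<ge> M \<Longrightarrow> t \<in> {a..b} \<Longrightarrow> \<bar>poly (q n) t - f t\<bar> < e / 4"
      unfolding eventually_sequentially dist_real_def by blast
    show "\<exists>M. \<forall>m\<ge>M. \<forall>n\<ge>M. dist (op_poly (q m) A) (op_poly (q n) A) < e"
    proof (intro exI allI impI)
      fix m n assume "m \<ge> M" "n \<ge> M"
      have "norm (op_poly (q m - q n) A) \<le> e / 2"
      proof (rule norm_op_poly_le[OF A])
        fix t assume "t \<in> real_spectrum A"
        then have "t \<in> {a..b}" using spec by blast
        then show "\<bar>poly (q m - q n) t\<bar> \<le> e / 2"
          using M[OF \<open>m \<ge> M\<close>, of t] M[OF \<open>n \<ge> M\<close>, of t] unfolding poly_diff by linarith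
      qed (use \<open>0 < e\<close> in auto)
      then show "dist (op_poly (q m) A) (op_poly (q n) A) < e"
        using \<open>0 < e\<close> by (simp add: dist_norm op_poly_diff)
    qed
  qed
  then obtain B where B: "(\<lambda>n. op_poly (q n) A) \<longlonglongrightarrow> B"
    using Cauchy_convergent_iff convergent_def by blast
  then show ?thesis
    using cfc_eqI[OF A uniform_limit_on_subset[OF q spec] B] by simp
qed

lemma cfc_approx:
  assumes "continuous_on {a..b} f"
  obtains q where "uniform_limit {a..b} (\<lambda>n. poly (q n)) f sequentially"
    and "(\<lambda>n. op_poly (q n) A) \<longlonglongrightarrow> cfc f A"
  using poly_uniform_approx[OF assms] cfc_tendsto by blast

lemma cfc_selfadj: "continuous_on {a..b} f \<Longrightarrow> selfadj (cfc f A)"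
  by (metis cfc_approx op_poly_selfadj[OF A] selfadj_limit)

text \<open>Commutation holds for polynomials in \<open>A\<close> and survives norm limits. Through
  the double commutant this places \<open>cfc f A\<close> in every von Neumann algebra that contains
  \<open>A\<close>.\<close>

lemma cfc_commute:
  assumes "continuous_on {a..b} f" "C o\<^sub>L A = A o\<^sub>L C"
  shows "C o\<^sub>L cfc f A = cfc f A o\<^sub>L C"
proof -
  obtain q where q: "(\<lambda>n. op_poly (q n) A) \<longlonglongrightarrow> cfc f A" using cfc_approx[OF assms(1)] by blast
  have "(\<lambda>n. C o\<^sub>L op_poly (q n) A) \<longlonglongrightarrow> (C o\<^sub>L cfc f A)"
    by (intro bounded_bilinear.tendsto[OF bounded_bilinear_blinfun_compose] tendsto_const q)
  moreover have "(\<lambda>n. C o\<^sub>L op_poly (q n) A) \<longlonglongrightarrow> (cfc f A o\<^sub>L C)"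
    unfolding op_poly_commute[OF assms(2)]
    by (intro bounded_bilinear.tendsto[OF bounded_bilinear_blinfun_compose] tendsto_const q)
  ultimately show ?thesis by (rule LIMSEQ_unique)
qed

lemma cfc_add:
  assumes f: "continuous_on {a..b} f" and g: "continuous_on {a..b} g"
  shows "cfc (\<lambda>t. f t + g t) A = cfc f A + cfc g A"
proof -
  obtain p where p: "uniform_limit {a..b} (\<lambda>n. poly (p n)) f sequentially"
    and p': "(\<lambda>n. op_poly (p n) A) \<longlonglongrightarrow> cfc f A" using cfc_approx[OF f] by blast
  obtain q where q: "uniform_limit {a..b} (\<lambda>n. poly (q n)) g sequentially"
    and q': "(\<lambda>n. op_poly (q n) A) \<longlonglongrightarrow> cfc g A" using cfc_approx[OF g] by blast
  have "uniform_limit {a..b} (\<lambda>n. poly (p n + q n)) (\<lambda>t. f t + g t) sequentially"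
    using uniform_limit_add[OF p q] by (simp add: poly_add_fun)
  then have "(\<lambda>n. op_poly (p n + q n) A) \<longlonglongrightarrow> cfc (\<lambda>t. f t + g t) A" by (rule cfc_tendsto)
  then show ?thesis using tendsto_add[OF p' q'] LIMSEQ_unique unfolding op_poly_add by blast
qed

lemma cfc_mult:
  assumes f: "continuous_on {a..b} f" and g: "continuous_on {a..b} g"
  shows "cfc (\<lambda>t. f t * g t) A = cfc f A o\<^sub>L cfc g A"
proof -
  obtain p where p: "uniform_limit {a..b} (\<lambda>n. poly (p n)) f sequentially"
    and p': "(\<lambda>n. op_poly (p n) A) \<longlonglongrightarrow> cfc f A" using cfc_approx[OF f] by blast
  obtain q where q: "uniform_limit {a..b} (\<lambda>n. poly (q n)) g sequentially"
    and q': "(\<lambda>n. op_poly (q n) A) \<longlonglongrightarrow> cfc g A" using cfc_approx[OF g] by blast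
  \<comment> \<open>Uniform limits are multiplicative only for bounded limit functions; here
    compactness of the interval gives boundedness.\<close>
  have "bounded (f ` {a..b})" "bounded (g ` {a..b})"
    using f g by (auto intro!: compact_imp_bounded compact_continuous_image)
  then have "uniform_limit {a..b} (\<lambda>n. poly (p n * q n)) (\<lambda>t. f t * g t) sequentially"
    using uniform_lim_mult[OF p q] by (simp add: poly_mult_fun)
  then have "(\<lambda>n. op_poly (p n * q n) A) \<longlonglongrightarrow> cfc (\<lambda>t. f t * g t) A" by (rule cfc_tendsto)
  moreover have "(\<lambda>n. op_poly (p n * q n) A) \<longlonglongrightarrow> (cfc f A o\<^sub>L cfc g A)"
    unfolding op_poly_mult by (intro bounded_bilinear.tendsto[OF bounded_bilinear_blinfun_compose] p' q')
  ultimately show ?thesis by (rule LIMSEQ_unique)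
qed

lemma cfc_scaleR: "continuous_on {a..b} f \<Longrightarrow> cfc (\<lambda>t. c * f t) A = c *\<^sub>R cfc f A"
  using cfc_mult[of "\<lambda>_. c" f] by (simp add: cfc_const[OF A] compose_simps)

lemma cfc_diff:
  "continuous_on {a..b} f \<Longrightarrow> continuous_on {a..b} g \<Longrightarrow>
   cfc (\<lambda>t. f t - g t) A = cfc f A - cfc g A"
  using cfc_add[of f "\<lambda>t. - 1 * g t"] cfc_scaleR[of g "- 1"] by (simp add: continuous_on_minus)

text \<open>The operator is the square of the self-adjoint operator obtained from the square root of
  \<open>f\<close>.\<close>

lemma cfc_nonneg:
  assumes f: "continuous_on {a..b} f" and "\<And>t. t \<in> {a..b} \<Longrightarrow> 0 \<le> f t"
  shows "0 \<le> inner x (blinfun_apply (cfc f A) x)"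
proof -
  have s: "continuous_on {a..b} (\<lambda>t. sqrt (f t))" by (intro continuous_intros f)
  have "cfc f A = cfc (\<lambda>t. sqrt (f t) * sqrt (f t)) A"
    using spec assms(2) by (intro cfc_cong) auto
  also have "\<dots> = cfc (\<lambda>t. sqrt (f t)) A o\<^sub>L cfc (\<lambda>t. sqrt (f t)) A" by (rule cfc_mult[OF s s])
  finally show ?thesis by (simp add: selfadj_inner[OF cfc_selfadj[OF s], symmetric, of _ "blinfun_apply _ _"])
qed

lemma cfc_mono:
  assumes "continuous_on {a..b} f" "continuous_on {a..b} g" "\<And>t. t \<in> {a..b} \<Longrightarrow> f t \<le> g t"
  shows "inner x (blinfun_apply (cfc f A) x) \<le> inner x (blinfun_apply (cfc g A) x)"
  using cfc_nonneg[of "\<lambda>t. g t - f t" x] assms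
  by (simp add: cfc_diff continuous_on_diff blinfun.diff_left inner_diff_right)

lemma cfc_norm_le:
  assumes f: "continuous_on {a..b} f" and "0 \<le> M" and M: "\<And>t. t \<in> {a..b} \<Longrightarrow> \<bar>f t\<bar> \<le> M"
  shows "norm (cfc f A) \<le> M"
proof (rule field_le_epsilon)
  fix e :: real assume "0 < e"
  obtain q where q: "uniform_limit {a..b} (\<lambda>n. poly (q n)) f sequentially"
    and q': "(\<lambda>n. op_poly (q n) A) \<longlonglongrightarrow> cfc f A" using cfc_approx[OF f] by blast
  have "\<forall>\<^sub>F n in sequentially. norm (op_poly (q n) A) \<le> M + e"
    using uniform_limitD[OF q \<open>0 < e\<close>]
  proof eventually_elim
    case (elim n)
    show ?case
    proof (rule norm_op_poly_le[OF A])
      fix t assume "t \<in> real_spectrum A"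
      then have "t \<in> {a..b}" using spec by blast
      then have "\<bar>poly (q n) t - f t\<bar> < e" "\<bar>f t\<bar> \<le> M" using elim M by (auto simp: dist_real_def)
      then show "\<bar>poly (q n) t\<bar> \<le> M + e" by linarith
    qed (use \<open>0 \<le> M\<close> \<open>0 < e\<close> in auto)
  qed
  then show "norm (cfc f A) \<le> M + e"
    by (rule tendsto_upperbound[OF tendsto_norm[OF q']]) simp
qed

text \<open>The bounds on \<open>f\<close> pass to the quadratic form by \<open>cfc_mono\<close>,
  and these locate the spectrum. This inclusion is the input for \<open>cfc_compose\<close>.\<close>

lemma real_spectrum_cfc:
  assumes f: "continuous_on {a..b} f" and "f ` {a..b} \<subseteq> {c..d}"
  shows "real_spectrum (cfc f A) \<subseteq> {c..d}"
proof (rule real_spectrum_bounds)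
  show "cfc f A \<in> bounded_ops" using cfc_selfadj[OF f] by blast
  fix x
  show "c * (norm x)\<^sup>2 \<le> inner x (cfc f A x)"
    using cfc_mono[OF continuous_on_const f, of c x] assms(2)
    by (auto simp: cfc_const[OF A] blinfun.scaleR_left power2_norm_eq_inner image_subset_iff)
  show "inner x (cfc f A x) \<le> d * (norm x)\<^sup>2"
    using cfc_mono[OF f continuous_on_const, of d x] assms(2)
    by (auto simp: cfc_const[OF A] blinfun.scaleR_left power2_norm_eq_inner image_subset_iff)
qed

lemma op_poly_cfc:
  assumes g: "continuous_on {a..b} g"
  shows "op_poly r (cfc g A) = cfc (\<lambda>t. poly r (g t)) A"
proof (induction r)
  case 0
  then show ?case using cfc_const[OF A, of 0] by simp
next
  case (pCons c r)
  have "continuous_on {a..b} (\<lambda>t. poly r (g t))" by (intro continuous_intros g)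
  then show ?case
    using pCons g by (simp add: op_poly_pCons cfc_add cfc_mult cfc_const[OF A] continuous_on_mult)
qed

text \<open>For polynomials \<open>r\<close> in place of \<open>h\<close> this is
  \<open>op_poly_cfc\<close>. Approximating \<open>h\<close> uniformly on \<open>{c..d}\<close>, the
  errors composed with \<open>g\<close> stay uniformly small, and \<open>cfc_norm_le\<close> turns
  them into operator errors.\<close>

lemma cfc_compose:
  assumes g: "continuous_on {a..b} g" and h: "continuous_on {c..d} h"
    and sub: "g ` {a..b} \<subseteq> {c..d}"
  shows "cfc h (cfc g A) = cfc (\<lambda>t. h (g t)) A"
proof -
  obtain r where r: "uniform_limit {c..d} (\<lambda>n. poly (r n)) h sequentially"
    using poly_uniform_approx[OF h] by blast
  have hg: "continuous_on {a..b} (\<lambda>t. h (g t))"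
    using continuous_on_compose2[OF h g] sub by simp
  have "(\<lambda>n. op_poly (r n) (cfc g A)) \<longlonglongrightarrow> cfc (\<lambda>t. h (g t)) A"
    unfolding op_poly_cfc[OF g]
  proof (rule tendstoI)
    fix e :: real assume "0 < e"
    then have "\<forall>\<^sub>F n in sequentially. \<forall>t\<in>{c..d}. dist (poly (r n) t) (h t) < e / 2"
      by (intro uniform_limitD[OF r]) simp
    then show "\<forall>\<^sub>F n in sequentially. dist (cfc (\<lambda>t. poly (r n) (g t)) A) (cfc (\<lambda>t. h (g t)) A) < e"
    proof eventually_elim
      case (elim n)
      have "norm (cfc (\<lambda>t. poly (r n) (g t) - h (g t)) A) \<le> e / 2"
        using elim sub \<open>0 < e\<close>
        by (intro cfc_norm_le continuous_intros g hg)
          (auto simp: dist_real_def image_subset_iff intro!: less_imp_le)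
      moreover have "cfc (\<lambda>t. poly (r n) (g t) - h (g t)) A = cfc (\<lambda>t. poly (r n) (g t)) A - cfc (\<lambda>t. h (g t)) A"
        by (intro cfc_diff continuous_intros g hg)
      ultimately show ?case using \<open>0 < e\<close> by (simp add: dist_norm)
    qed
  qed
  moreover have "uniform_limit (real_spectrum (cfc g A)) (\<lambda>n. poly (r n)) h sequentially"
    by (rule uniform_limit_on_subset[OF r real_spectrum_cfc[OF g sub]])
  ultimately show ?thesis using cfc_eqI[OF cfc_selfadj[OF g]] by blast
qed

end

subsection \<open>Tracial von Neumann algebras\<close>

lemma positive_opI:
  "selfadj A \<Longrightarrow> (\<And>x. 0 \<le> inner x (blinfun_apply A x)) \<Longrightarrow> positive_op A"
  by (auto simp: positive_op_def complex_nonneg_Reals_iff selfadj_Im_cinner inner_Re_cinner)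

lemma selfadj_adj_compose: "X \<in> bounded_ops \<Longrightarrow> selfadj (adj X o\<^sub>L X)"
  by (simp add: selfadj_def)

lemma inner_adj_compose:
  "X \<in> bounded_ops \<Longrightarrow> inner x (blinfun_apply (adj X o\<^sub>L X) x) = (norm (blinfun_apply X x))\<^sup>2"
  by (simp add: power2_norm_eq_inner inner_adj)

lemma adj_compose_eq_0: "X \<in> bounded_ops \<Longrightarrow> adj X o\<^sub>L X = 0 \<Longrightarrow> X = 0"
  using inner_adj_compose[of X] by (auto intro!: blinfun_eqI)

text \<open>The double commutant property as a membership criterion; it yields closure under sums,
  products, inverses and functional calculus.\<close>

lemma von_neumann_algebraI:
  assumes "von_neumann_algebra N" "A \<in> bounded_ops"
    and "\<And>C. C \<in> bounded_ops \<Longrightarrow> (\<And>B. B \<in> N \<Longrightarrow> B o\<^sub>L C = C o\<^sub>L B) \<Longrightarrow> C o\<^sub>L A = A o\<^sub>L C"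
  shows "A \<in> N"
proof -
  have "A \<in> commutant (commutant N)"
    using assms(2,3) by (auto simp: commutant_def)
  then show ?thesis using assms(1) by (simp add: von_neumann_algebra_def)
qed

locale tracial_vn_algebra =
  fixes N :: "('a::chilbert_space) op set" and \<tau> :: "'a op \<Rightarrow> complex"
  assumes vn: "von_neumann_algebra N"
    and trace: "tracial_state N \<tau>"
    and faithful: "faithful_on N \<tau>"
begin

lemma bounded_ops_if_mem [dest, simp]: "A \<in> N \<Longrightarrow> A \<in> bounded_ops"
  using vn by (auto simp: von_neumann_algebra_def)

lemma adj_mem [simp, intro]: "A \<in> N \<Longrightarrow> adj A \<in> N"
  using vn by (auto simp: von_neumann_algebra_def)

lemma mem_closed [simp, intro]:
  "id_blinfun \<in> N" "scalar_op c \<in> N"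
  "A \<in> N \<Longrightarrow> B \<in> N \<Longrightarrow> A + B \<in> N"
  "A \<in> N \<Longrightarrow> B \<in> N \<Longrightarrow> A - B \<in> N"
  "A \<in> N \<Longrightarrow> - A \<in> N"
  "A \<in> N \<Longrightarrow> r *\<^sub>R A \<in> N"
  by (rule von_neumann_algebraI[OF vn]; simp add: compose_simps flip: scalar_op_commute)+

lemma compose_mem [simp, intro]:
  assumes "A \<in> N" "B \<in> N"
  shows "A o\<^sub>L B \<in> N"
proof (rule von_neumann_algebraI[OF vn])
  fix C assume "\<And>B. B \<in> N \<Longrightarrow> B o\<^sub>L C = C o\<^sub>L B"
  with assms have "A o\<^sub>L C = C o\<^sub>L A" "B o\<^sub>L C = C o\<^sub>L B" by auto
  then show "C o\<^sub>L (A o\<^sub>L B) = (A o\<^sub>L B) o\<^sub>L C" by (metis compose_assoc)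
qed (use assms in auto)

lemma inverse_mem:
  assumes "A \<in> N" "R \<in> bounded_ops" "R o\<^sub>L A = id_blinfun" "A o\<^sub>L R = id_blinfun"
  shows "R \<in> N"
proof (rule von_neumann_algebraI[OF vn assms(2)])
  fix C assume "\<And>B. B \<in> N \<Longrightarrow> B o\<^sub>L C = C o\<^sub>L B"
  then have "A o\<^sub>L C = C o\<^sub>L A" using assms(1) by blast
  then show "C o\<^sub>L R = R o\<^sub>L C" by (metis assms(3,4) compose_assoc compose_id)
qed

lemma cfc_mem:
  assumes "A \<in> N" "selfadj A" "real_spectrum A \<subseteq> {a..b}" "continuous_on {a..b} f"
  shows "cfc f A \<in> N"
proof (rule von_neumann_algebraI[OF vn])
  show "cfc f A \<in> bounded_ops" using cfc_selfadj[OF assms(2-4)] by blast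
  fix C assume "\<And>B. B \<in> N \<Longrightarrow> B o\<^sub>L C = C o\<^sub>L B"
  then have "C o\<^sub>L A = A o\<^sub>L C" using assms(1) by simp
  then show "C o\<^sub>L cfc f A = cfc f A o\<^sub>L C" by (rule cfc_commute[OF assms(2-4)])
qed

lemma tr_add: "A \<in> N \<Longrightarrow> B \<in> N \<Longrightarrow> \<tau> (A + B) = \<tau> A + \<tau> B"
  and tr_scalar: "A \<in> N \<Longrightarrow> \<tau> (scalar_op c o\<^sub>L A) = c * \<tau> A"
  and tr_id [simp]: "\<tau> id_blinfun = 1"
  and tr_commute: "A \<in> N \<Longrightarrow> B \<in> N \<Longrightarrow> \<tau> (A o\<^sub>L B) = \<tau> (B o\<^sub>L A)"
  using trace by (auto simp: tracial_state_def)

lemma tr_scaleR: "A \<in> N \<Longrightarrow> \<tau> (r *\<^sub>R A) = complex_of_real r * \<tau> A"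
  using tr_scalar[of A "complex_of_real r"] by (simp add: scalar_op_of_real compose_simps)

lemma tr_minus: "A \<in> N \<Longrightarrow> \<tau> (- A) = - \<tau> A"
  using tr_scaleR[of A "-1"] by simp

lemma tr_diff: "A \<in> N \<Longrightarrow> B \<in> N \<Longrightarrow> \<tau> (A - B) = \<tau> A - \<tau> B"
  using tr_add[of A "- B"] tr_minus[of B] by simp

lemmas tr_simps = tr_add tr_diff tr_minus tr_scaleR

lemma tr_positive:
  assumes "A \<in> N" "selfadj A" "\<And>x. 0 \<le> inner x (blinfun_apply A x)"
  shows "0 \<le> Re (\<tau> A)" "Im (\<tau> A) = 0"
proof -
  have "\<tau> A \<in> \<real>\<^sub>\<ge>\<^sub>0"
    using trace positive_opI[OF assms(2,3)] assms(1) by (simp add: tracial_state_def)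
  then show "0 \<le> Re (\<tau> A)" "Im (\<tau> A) = 0" by (auto simp: complex_nonneg_Reals_iff)
qed

lemma tr_faithful:
  assumes "A \<in> N" "selfadj A" "\<And>x. 0 \<le> inner x (blinfun_apply A x)" "Re (\<tau> A) \<le> 0"
  shows "A = 0"
proof -
  have "\<tau> A = 0" using tr_positive[OF assms(1-3)] assms(4) by (simp add: complex_eq_iff)
  then show ?thesis
    using faithful positive_opI[OF assms(2,3)] assms(1) by (simp add: faithful_on_def)
qed

text \<open>Adding \<open>norm A\<close> times the identity makes the operator positive, so its
  trace is real, and the added term has real trace as well.\<close>

lemma tr_selfadj_real:
  assumes "A \<in> N" "selfadj A"
  shows "Im (\<tau> A) = 0"
proof -
  have "0 \<le> inner x ((A + norm A *\<^sub>R id_blinfun) x)" for x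
  proof -
    have "- inner x (A x) \<le> norm x * norm (A x)" using norm_cauchy_schwarz[of "- x" "A x"] by simp
    also have "\<dots> \<le> norm x * (norm A * norm x)" by (intro mult_left_mono norm_blinfun) auto
    finally show ?thesis
      by (simp add: blinfun.bilinear_simps inner_simps mult_ac power2_eq_square flip: power2_norm_eq_inner)
  qed
  then have "Im (\<tau> (A + norm A *\<^sub>R id_blinfun)) = 0"
    using assms by (intro tr_positive) auto
  then show ?thesis using assms by (simp add: tr_simps)
qed

text \<open>The difference \<open>A - adj A\<close> becomes self-adjoint after multiplication by the
  imaginary unit, so the trace of the difference has real part 0.\<close>

lemma Re_tr_adj:
  assumes "A \<in> N"
  shows "Re (\<tau> (adj A)) = Re (\<tau> A)"
proof -
  have "adj (scalar_op \<i> o\<^sub>L (A - adj A)) = scalar_op \<i> o\<^sub>L (A - adj A)"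
    using assms scalar_op_commute[of "adj A - A" "- \<i>"]
    by (simp add: scalar_op_minus compose_simps)
  then have "selfadj (scalar_op \<i> o\<^sub>L (A - adj A))"
    using assms by (simp add: selfadj_def)
  then have "Im (\<tau> (scalar_op \<i> o\<^sub>L (A - adj A))) = 0"
    using assms by (intro tr_selfadj_real) auto
  then show ?thesis using assms by (simp add: tr_scalar tr_simps)
qed

text \<open>Symmetrisation: \<open>A + adj A\<close> is positive, with twice the real quadratic form
  and twice the real trace. This allows \<open>A\<close> that are not self-adjoint, such as
  \<open>1 - V\<close> for a unitary \<open>V\<close>.\<close>

lemma Re_tr_nonneg:
  assumes "A \<in> N" "\<And>x. 0 \<le> inner x (blinfun_apply A x)"
  shows "0 \<le> Re (\<tau> A)"
proof -
  have "0 \<le> Re (\<tau> (A + adj A))"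
  proof (rule tr_positive(1))
    show "selfadj (A + adj A)" using assms(1) by (simp add: selfadj_def add.commute)
    show "0 \<le> inner x ((A + adj A) x)" for x
      using assms(2)[of x] inner_adj[of A x x] assms(1)
      by (simp add: blinfun.add_left inner_add_right inner_commute)
  qed (use assms in auto)
  then show ?thesis using assms(1) by (simp add: tr_add Re_tr_adj)
qed

lemma Re_tr_mono:
  assumes "A \<in> N" "B \<in> N" "\<And>x. inner x (blinfun_apply A x) \<le> inner x (blinfun_apply B x)"
  shows "Re (\<tau> A) \<le> Re (\<tau> B)"
  using Re_tr_nonneg[of "B - A"] assms by (simp add: blinfun.diff_left inner_diff_right tr_diff)

lemma Re_tr_le_norm:
  assumes "A \<in> N"
  shows "Re (\<tau> A) \<le> norm A"
proof -
  have "Re (\<tau> A) \<le> Re (\<tau> (norm A *\<^sub>R id_blinfun))"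
  proof (rule Re_tr_mono)
    fix x
    have "inner x (A x) \<le> norm x * norm (A x)" by (rule norm_cauchy_schwarz)
    also have "\<dots> \<le> norm x * (norm A * norm x)" by (intro mult_left_mono norm_blinfun) auto
    finally show "inner x (A x) \<le> inner x ((norm A *\<^sub>R id_blinfun) x)"
      by (simp add: blinfun.bilinear_simps mult_ac power2_eq_square flip: power2_norm_eq_inner)
  qed (use assms in auto)
  then show ?thesis by (simp add: tr_scaleR)
qed

section \<open>Traces of unitaries and symmetries\<close>

lemma unitaryD:
  assumes "U \<in> unitary_group N"
  shows "U \<in> N" "adj U o\<^sub>L U = id_blinfun" "U o\<^sub>L adj U = id_blinfun"
  using assms by (auto simp: unitary_group_def)

lemma tr_adj_compose_faithful:
  assumes "X \<in> N" "Re (\<tau> (adj X o\<^sub>L X)) \<le> 0"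
  shows "X = 0"
proof -
  have "adj X o\<^sub>L X = 0"
  proof (rule tr_faithful)
    show "0 \<le> inner x ((adj X o\<^sub>L X) x)" for x
      using assms(1) by (subst inner_adj_compose) auto
  qed (use assms in \<open>auto intro: selfadj_adj_compose\<close>)
  then show ?thesis by (rule adj_compose_eq_0[OF bounded_ops_if_mem[OF assms(1)]])
qed

lemma unitary_norm:
  assumes "U \<in> unitary_group N"
  shows "norm (blinfun_apply U x) = norm x"
  using inner_adj_compose[of U x] unitaryD[OF assms]
  by (simp add: power2_norm_eq_inner[symmetric])

text \<open>For a symmetry \<open>S\<close>, the operator \<open>Q = 1 + S\<close> is twice a
  projection, and \<open>1 - V\<close> has nonnegative real quadratic form. Hence
  \<open>Q (1 - V) Q\<close> has nonnegative real trace, which by traciality is twice that of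
  \<open>Q (1 - V)\<close>.\<close>

lemma Re_tr_symmetry_le:
  assumes S: "S \<in> unitary_group N" "adj S = S" and V: "V \<in> unitary_group N"
  shows "Re (\<tau> (S o\<^sub>L V)) - Re (\<tau> S) \<le> 1 - Re (\<tau> V)"
proof -
  note SN = unitaryD[OF S(1)] and VN = unitaryD(1)[OF V]
  define Q where "Q = id_blinfun + S"
  have Q: "Q \<in> N" using SN by (simp add: Q_def)
  have QQ: "Q o\<^sub>L Q = 2 *\<^sub>R Q"
    using SN S(2) by (simp add: Q_def compose_simps scaleR_2)
  have saQ: "selfadj Q" using SN S(2) by (simp add: Q_def selfadj_def)
  define D where "D = id_blinfun - V"
  have D: "D \<in> N" using VN by (simp add: D_def)
  have "0 \<le> Re (\<tau> (Q o\<^sub>L (D o\<^sub>L Q)))"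
  proof (rule Re_tr_nonneg)
    fix x
    have "inner y (V y) \<le> norm y * norm y" for y
      using norm_cauchy_schwarz[of y "V y"] unitary_norm[OF V] by simp
    then have "0 \<le> inner y (D y)" for y
      by (simp add: D_def blinfun.diff_left inner_diff_right power2_eq_square flip: power2_norm_eq_inner)
    then show "0 \<le> inner x ((Q o\<^sub>L (D o\<^sub>L Q)) x)"
      by (simp add: selfadj_inner[OF saQ, symmetric])
  qed (use Q D in auto)
  also have "\<tau> (Q o\<^sub>L (D o\<^sub>L Q)) = \<tau> ((Q o\<^sub>L Q) o\<^sub>L D)"
    using Q D by (metis compose_assoc compose_mem tr_commute)
  also have "\<dots> = 2 * \<tau> (Q o\<^sub>L D)" using Q D by (simp add: QQ compose_simps tr_scaleR)
  also have "\<tau> (Q o\<^sub>L D) = 1 - \<tau> V + \<tau> S - \<tau> (S o\<^sub>L V)"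
    using SN VN by (simp add: Q_def D_def compose_simps tr_simps)
  finally show ?thesis by simp
qed

lemma unitary_minus: "U \<in> unitary_group N \<Longrightarrow> - U \<in> unitary_group N"
  by (auto simp: unitary_group_def compose_simps)

lemma unitary_adj: "U \<in> unitary_group N \<Longrightarrow> adj U \<in> unitary_group N"
  by (auto simp: unitary_group_def)

lemma unitary_id: "id_blinfun \<in> unitary_group N"
  by (auto simp: unitary_group_def)

text \<open>The Cayley transforms \<open>W = (1 + tJ)(1 - tJ)\<^sup>-\<^sup>1\<close> of the skew-adjoint part \<open>J\<close> of \<open>T\<close> satisfy
  \<open>W - 1 = 2tJ + O(t\<^sup>2)\<close>, so that the first order term in \<open>t\<close> of the hypothesis is
  \<open>Re \<tau>(T\<^sup>*J) = \<tau>(J\<^sup>*J) \<le> 0\<close>.\<close>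

lemma selfadj_if_tr_le:
  assumes T: "T \<in> unitary_group N"
    and le: "\<And>W. W \<in> unitary_group N \<Longrightarrow>
      Re (\<tau> (adj T o\<^sub>L W)) - Re (\<tau> (adj T)) \<le> 1 - Re (\<tau> W)"
  shows "adj T = T"
proof -
  note TN = unitaryD(1)[OF T]
  define J where "J = (1 / 2) *\<^sub>R (T - adj T)"
  have J: "J \<in> N" using TN by (simp add: J_def)
  have adjJ: "adj J = - J" using TN by (simp add: J_def flip: scaleR_minus_right)
  have Jskew: "inner x (J x) = 0" for x
    using inner_adj[of J x x] J by (simp add: adjJ blinfun.minus_left inner_commute)
  define k where "k = Re (\<tau> (adj J o\<^sub>L J))"
  \<comment> \<open>Since \<open>J\<close> is skew-adjoint, the traces of \<open>adj T J\<close> and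
    of \<open>- T J\<close> have equal real parts, and \<open>k\<close> is their mean.\<close>
  have tTJ: "Re (\<tau> (adj T o\<^sub>L J)) = k"
  proof -
    have "Re (\<tau> (adj (adj T o\<^sub>L J))) = Re (\<tau> (adj T o\<^sub>L J))"
      using TN J by (intro Re_tr_adj) auto
    moreover have "\<tau> (adj (adj T o\<^sub>L J)) = - \<tau> (T o\<^sub>L J)"
      using TN J tr_commute[of J T] by (simp add: adjJ compose_simps tr_simps)
    moreover have "k = (Re (\<tau> (adj T o\<^sub>L J)) - Re (\<tau> (T o\<^sub>L J))) / 2"
    proof -
      have "adj J = (1 / 2) *\<^sub>R (adj T - T)" using TN by (simp add: J_def)
      then show ?thesis using TN J by (simp add: k_def compose_simps tr_simps)
    qed
    ultimately show ?thesis by simp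
  qed
  have tJ: "Re (\<tau> J) = 0" using Re_tr_adj[OF J] J by (simp add: adjJ tr_minus)
  define M where "M = norm J * norm J"
  have bound: "k \<le> 2 * M * t" if t: "t > 0" for t
  proof -
    define E F where "E = id_blinfun - t *\<^sub>R J" and "F = id_blinfun + t *\<^sub>R J"
    have E: "E \<in> N" and F: "F \<in> N" using J by (auto simp: E_def F_def)
    have adjE: "adj E = F" and adjF: "adj F = E" using J by (simp_all add: E_def F_def adjJ)
    have EF: "E o\<^sub>L F = F o\<^sub>L E" by (simp add: E_def F_def compose_simps algebra_simps)
    \<comment> \<open>The skew part contributes nothing to the real form, so \<open>E\<close> is
      coercive with constant 1 for every \<open>t\<close>. This gives both the inverse
      \<open>R\<close> and the bound \<open>norm R \<le> 1\<close>.\<close>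
    have coer: "inner x (E x) = (norm x)\<^sup>2" for x
      by (simp add: E_def blinfun.bilinear_simps inner_simps Jskew power2_norm_eq_inner)
    have "invertible_op E"
      using E coer by (intro coercive_invertible[where e = 1]) auto
    then obtain R where R0: "R \<in> bounded_ops" and RE: "R o\<^sub>L E = id_blinfun" and ER: "E o\<^sub>L R = id_blinfun"
      unfolding invertible_op_def by blast
    have R: "R \<in> N" by (rule inverse_mem[OF E R0 RE ER])
    have RF: "R o\<^sub>L F = F o\<^sub>L R" by (metis EF RE ER compose_assoc compose_id)
    have aRF: "adj R o\<^sub>L F = id_blinfun" "F o\<^sub>L adj R = id_blinfun"
      using arg_cong[OF ER, of adj] arg_cong[OF RE, of adj] E R by (simp_all add: adjE)
    have nR: "norm R \<le> 1"
    proof (rule norm_blinfun_bound)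
      fix y
      have "(norm (R y))\<^sup>2 = inner (R y) ((E o\<^sub>L R) y)" using coer[of "R y"] by simp
      also have "\<dots> \<le> norm (R y) * norm y" unfolding ER by (simp add: norm_cauchy_schwarz)
      finally show "norm (R y) \<le> 1 * norm y"
        by (cases "norm (R y) = 0") (auto simp: power2_eq_square)
    qed simp
    define W where "W = F o\<^sub>L R"
    have adjW: "adj W = adj R o\<^sub>L E" using F R by (simp add: W_def adjF)
    have W1: "adj W o\<^sub>L W = id_blinfun"
    proof -
      have "adj W o\<^sub>L W = adj R o\<^sub>L ((E o\<^sub>L F) o\<^sub>L R)"
        unfolding adjW by (simp add: W_def compose_assoc)
      also have "\<dots> = (adj R o\<^sub>L F) o\<^sub>L (E o\<^sub>L R)" by (simp add: EF compose_assoc)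
      finally show ?thesis by (simp add: aRF ER)
    qed
    have W2: "W o\<^sub>L adj W = id_blinfun"
    proof -
      have "W o\<^sub>L adj W = R o\<^sub>L ((F o\<^sub>L adj R) o\<^sub>L E)" 
        unfolding adjW by (simp add: W_def compose_assoc flip: RF)
      then show ?thesis by (simp add: aRF RE)
    qed
    have W: "W \<in> unitary_group N" using F R W1 W2 by (auto simp: unitary_group_def W_def)
    define Z where "Z = J o\<^sub>L (J o\<^sub>L R)"
    have Z: "Z \<in> N" using J R by (simp add: Z_def)
    have Weq: "W = id_blinfun + (2 * t) *\<^sub>R J + (2 * t\<^sup>2) *\<^sub>R Z"
    proof -
      \<comment> \<open>The equation \<open>E R = 1\<close> read as a fixed point equation;
        inserting it into itself once isolates the term linear in \<open>t\<close> and leaves the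
        remainder \<open>Z\<close>.\<close>
      have R1: "R = id_blinfun + t *\<^sub>R (J o\<^sub>L R)"
        using ER by (simp add: E_def compose_simps algebra_simps)
      have "W = R + t *\<^sub>R (J o\<^sub>L R)" by (simp add: W_def F_def compose_simps)
      also have "\<dots> = id_blinfun + (2 * t) *\<^sub>R (J o\<^sub>L R)"
        using R1 by (simp add: algebra_simps scaleR_2 flip: scaleR_scaleR)
      also have "J o\<^sub>L R = J + t *\<^sub>R Z"
        by (subst R1) (simp add: Z_def compose_simps)
      finally show ?thesis by (simp add: algebra_simps power2_eq_square)
    qed
    have nZ: "norm Z \<le> M"
    proof -
      have "norm Z \<le> norm J * (norm J * norm R)"
        unfolding Z_def
        by (intro order_trans[OF norm_blinfun_compose] mult_left_mono norm_blinfun_compose) auto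
      also have "\<dots> \<le> norm J * (norm J * 1)" using nR by (intro mult_left_mono) auto
      finally show ?thesis by (simp add: M_def)
    qed
    have nT: "norm (adj T) \<le> 1"
      by (rule norm_blinfun_bound) (simp_all add: unitary_norm[OF unitary_adj[OF T]])
    have b1: "- Re (\<tau> Z) \<le> M"
      using Re_tr_le_norm[of "- Z"] Z nZ by (simp add: tr_minus)
    have b2: "- Re (\<tau> (adj T o\<^sub>L Z)) \<le> M"
    proof -
      have "norm (adj T o\<^sub>L Z) \<le> norm (adj T) * norm Z" by (rule norm_blinfun_compose)
      also have "\<dots> \<le> 1 * M" using nT nZ by (intro mult_mono) auto
      finally show ?thesis
        using Re_tr_le_norm[of "- (adj T o\<^sub>L Z)"] Z TN by (simp add: tr_minus)
    qed
    have "\<tau> (adj T o\<^sub>L W) = \<tau> (adj T) + 2 * t * \<tau> (adj T o\<^sub>L J) + 2 * t\<^sup>2 * \<tau> (adj T o\<^sub>L Z)"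
      unfolding Weq using TN J Z by (simp add: compose_simps tr_simps)
    moreover have "\<tau> W = 1 + 2 * t * \<tau> J + 2 * t\<^sup>2 * \<tau> Z"
      unfolding Weq using J Z by (simp add: tr_simps)
    ultimately have "2 * t * k \<le> 2 * t\<^sup>2 * (- Re (\<tau> Z)) + 2 * t\<^sup>2 * (- Re (\<tau> (adj T o\<^sub>L Z)))"
      using le[OF W] tTJ tJ by (simp flip: of_real_power)
    also have "\<dots> \<le> 2 * t\<^sup>2 * M + 2 * t\<^sup>2 * M" by (intro add_mono mult_left_mono b1 b2) auto
    finally have "(2 * t) * k \<le> (2 * t) * (2 * M * t)" by (simp add: power2_eq_square algebra_simps)
    then show ?thesis using t by (simp only: mult_le_cancel_left_pos mult_pos_pos zero_less_numeral)
  qed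
  have "k \<le> 0"
  proof (rule field_le_epsilon)
    fix e :: real assume e: "0 < e"
    have M: "0 \<le> M" by (simp add: M_def)
    \<comment> \<open>This \<open>t\<close> makes the bound at most \<open>e\<close>; the added 1
      keeps the denominator positive when \<open>M = 0\<close>.\<close>
    have "k \<le> 2 * M * (e / (2 * M + 1))" using e M by (intro bound) (simp add: add_nonneg_pos)
    also have "\<dots> \<le> e" using e M by (simp add: field_simps)
    finally show "k \<le> 0 + e" by simp
  qed
  then have "J = 0" using J unfolding k_def by (intro tr_adj_compose_faithful)
  then show ?thesis by (simp add: J_def)
qed

end

subsection \<open>Isometries of unitary groups\<close>

lemma powr_neg_ge:
  fixes t a :: real
  assumes "0 < t" "0 \<le> a"
  shows "1 + a * (1 - t) \<le> t powr (- a)"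
proof -
  have "1 + a * (1 - t) \<le> 1 + (- a * ln t)"
    using mult_left_mono[OF ln_le_minus_one[OF assms(1)] assms(2)] by (simp add: algebra_simps)
  also have "\<dots> \<le> t powr (- a)" using assms(1) exp_ge_add_one_self[of "- a * ln t"] by (simp add: powr_def)
  finally show ?thesis .
qed

text \<open>With \<open>z = a (1 - t)\<close>, inverting \<open>powr_neg_ge\<close> gives
  \<open>1 - t powr a \<ge> z / (1 + z)\<close>, and the denominator is at most
  \<open>1 + a\<close>.\<close>

lemma one_minus_powr_ge:
  fixes t a :: real
  assumes "0 \<le> t" "t \<le> 1" "0 < a"
  shows "a / (1 + a) * (1 - t) \<le> 1 - t powr a"
proof (cases "t = 0")
  case False
  define z where "z = a * (1 - t)"
  have z: "0 \<le> z" "z \<le> a" using assms by (auto simp: z_def mult_left_le)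
  have "1 + z \<le> inverse (t powr a)"
    using powr_neg_ge[of t a] False assms by (simp add: z_def powr_minus)
  then have "t powr a * (1 + z) \<le> 1" using False assms by (simp add: field_simps)
  then have "t powr a \<le> 1 / (1 + z)" using z by (simp add: field_simps)
  moreover have "z / (1 + a) \<le> z / (1 + z)" using z by (intro divide_left_mono) auto
  moreover have "z / (1 + z) = 1 - 1 / (1 + z)" using z by (simp add: field_simps)
  ultimately show ?thesis by (simp add: z_def)
qed (use assms in auto)

text \<open>Since \<open>t + (1 - t) = 1\<close>, the deviation is the sum of
  \<open>t powr s - t\<close> and the same expression at \<open>1 - t\<close>. Both have the sign
  \<open>\<sigma>\<close>: positive for concave powers, negative for convex ones.\<close>

lemma powr_sum_deviation:
  fixes s :: real
  assumes "0 < s" "s \<noteq> 1"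
  shows "\<exists>c>0. \<exists>\<sigma>. \<forall>t\<in>{0..1}. c * (t * (1 - t)) \<le> \<sigma> * (t powr s + (1 - t) powr s - 1)"
proof -
  define \<sigma> :: real where "\<sigma> = (if s < 1 then 1 else - 1)"
  \<comment> \<open>After \<open>t\<close> is factored out of \<open>t powr s - t\<close>, these are
    the slopes from \<open>powr_neg_ge\<close> with \<open>a = 1 - s\<close> and from
    \<open>one_minus_powr_ge\<close> with \<open>a = s - 1\<close>.\<close>
  define c where "c = (if s < 1 then 1 - s else (s - 1) / s)"
  have c: "0 < c" using assms by (simp add: c_def)
  have half: "c * (t * (1 - t)) \<le> \<sigma> * (t powr s - t)" if "0 \<le> t" "t \<le> 1" for t
  proof (cases "t = 0")
    case False
    have ts: "t powr s = t * t powr (s - 1)" using False that by (simp add: powr_diff)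
    have "c * (1 - t) \<le> \<sigma> * (t powr (s - 1) - 1)"
    proof (cases "s < 1")
      case True
      then show ?thesis using powr_neg_ge[of t "1 - s"] False that by (simp add: c_def \<sigma>_def)
    next
      case False
      then show ?thesis using one_minus_powr_ge[of t "s - 1"] that assms by (simp add: c_def \<sigma>_def)
    qed
    then have "t * (c * (1 - t)) \<le> t * (\<sigma> * (t powr (s - 1) - 1))" using that by (intro mult_left_mono)
    then show ?thesis by (simp add: ts algebra_simps)
  qed simp
  have "2 * c * (t * (1 - t)) \<le> \<sigma> * (t powr s + (1 - t) powr s - 1)" if "t \<in> {0..1}" for t
    using half[of t] half[of "1 - t"] that by (simp add: algebra_simps)
  then show ?thesis using c by (intro exI[of _ "2 * c"] conjI exI[of _ \<sigma>]) auto
qed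

lemma powr_sum_deviation_4:
  fixes s :: real
  assumes "0 < s" "s \<noteq> 1"
  shows "\<exists>c>0. \<exists>\<sigma>. \<forall>t\<in>{0..4}. c * (t * (4 - t)) \<le> \<sigma> * (t powr s + (4 - t) powr s - 4 powr s)"
proof -
  obtain c \<sigma> where "0 < c"
    and c: "\<And>t. t \<in> {0..1} \<Longrightarrow> c * (t * (1 - t)) \<le> \<sigma> * (t powr s + (1 - t) powr s - 1)"
    using powr_sum_deviation[OF assms] by blast
  \<comment> \<open>Rescaling by \<open>t = 4 u\<close>: the powers contribute
    \<open>4 powr s\<close>, and \<open>u (1 - u)\<close> is \<open>t (4 - t) / 16\<close>.\<close>
  have "(4 powr s * c / 16) * (t * (4 - t)) \<le> \<sigma> * (t powr s + (4 - t) powr s - 4 powr s)"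
    if t: "t \<in> {0..4}" for t
  proof -
    define u where "u = t / 4"
    have tu: "t = 4 * u" and u: "u \<in> {0..1}" using t by (auto simp: u_def)
    have 1: "t powr s = 4 powr s * u powr s" using u by (simp add: tu powr_mult)
    have "4 - t = 4 * (1 - u)" by (simp add: tu)
    then have 2: "(4 - t) powr s = 4 powr s * (1 - u) powr s" using u by (simp only: powr_mult)
    have "4 powr s * (c * (u * (1 - u))) \<le> 4 powr s * (\<sigma> * (u powr s + (1 - u) powr s - 1))"
      using c[OF u] by (intro mult_left_mono) auto
    then show ?thesis unfolding 1 2 by (simp add: tu algebra_simps)
  qed
  then show ?thesis using \<open>0 < c\<close>
    by (intro exI[of _ "4 powr s * c / 16"] conjI exI[of _ \<sigma>]) auto
qed

section \<open>The p-norm through the functional calculus\<close>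

lemma real_spectrum_adj_compose:
  assumes "X \<in> bounded_ops"
  shows "real_spectrum (adj X o\<^sub>L X) \<subseteq> {0..(norm X)\<^sup>2}"
proof (rule real_spectrum_bounds)
  fix x
  show "0 * (norm x)\<^sup>2 \<le> inner x ((adj X o\<^sub>L X) x)" by (simp add: inner_adj_compose[OF assms] del: blinfun_apply_blinfun_compose)
  have "(norm (X x))\<^sup>2 \<le> (norm X * norm x)\<^sup>2" by (intro power_mono norm_blinfun) auto
  then show "inner x ((adj X o\<^sub>L X) x) \<le> (norm X)\<^sup>2 * (norm x)\<^sup>2"
    by (simp add: inner_adj_compose[OF assms] power_mult_distrib del: blinfun_apply_blinfun_compose)
qed (use assms in auto)

lemma continuous_on_powr_const:
  "0 < s \<Longrightarrow> continuous_on {0..b} (\<lambda>t::real. t powr s)"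
  by (intro continuous_on_powr' continuous_intros) auto

text \<open>Composing the square root with the power gives \<open>|X|^p\<close> as one function of
  \<open>adj X X\<close>, so the absolute value disappears from all later computations.\<close>

lemma op_powr_op_abs:
  assumes X: "X \<in> bounded_ops" and p: "0 < p"
  shows "op_powr (op_abs X) p = cfc (\<lambda>t. t powr (p / 2)) (adj X o\<^sub>L X)"
proof -
  let ?B = "adj X o\<^sub>L X"
  note sp = real_spectrum_adj_compose[OF X]
  have "cfc (\<lambda>t. t powr p) (cfc sqrt ?B) = cfc (\<lambda>t. sqrt t powr p) ?B"
    by (rule cfc_compose[OF selfadj_adj_compose[OF X] sp _ continuous_on_powr_const[OF p, of "norm X"]])
       (auto intro!: continuous_intros real_le_lsqrt)
  also have "\<dots> = cfc (\<lambda>t. t powr (p / 2)) ?B"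
    using sp by (intro cfc_cong) (auto simp: powr_powr powr_half_sqrt[symmetric])
  finally show ?thesis by (simp add: op_powr_def op_abs_def)
qed

section \<open>Distances of a unitary from 1 and -1\<close>

context tracial_vn_algebra
begin

text \<open>The outer exponents \<open>1 / p\<close> and \<open>p\<close> cancel because the trace
  is nonnegative.\<close>

lemma Lp_norm_powr:
  assumes X: "X \<in> N" and p: "0 < p"
  shows "Lp_norm \<tau> p X powr p = Re (\<tau> (cfc (\<lambda>t. t powr (p / 2)) (adj X o\<^sub>L X)))"
proof -
  have Xb: "X \<in> bounded_ops" using X by auto
  note * = selfadj_adj_compose[OF Xb] real_spectrum_adj_compose[OF Xb]
  have c: "continuous_on {0..(norm X)\<^sup>2} (\<lambda>t. t powr (p / 2))"
    using p by (intro continuous_on_powr_const) simp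
  have "0 \<le> Re (\<tau> (cfc (\<lambda>t. t powr (p / 2)) (adj X o\<^sub>L X)))"
  proof (rule Re_tr_nonneg)
    show "cfc (\<lambda>t. t powr (p / 2)) (adj X o\<^sub>L X) \<in> N" using X by (intro cfc_mem[OF _ * c]) auto
    show "0 \<le> inner x (cfc (\<lambda>t. t powr (p / 2)) (adj X o\<^sub>L X) x)" for x
      by (rule cfc_nonneg[OF * c]) simp
  qed
  then show ?thesis using p by (simp add: Lp_norm_def op_powr_op_abs[OF Xb p] powr_powr)
qed

text \<open>For unitary \<open>U\<close> this is the operator \<open>B = |U - 1|^2\<close> of the
  overview.\<close>

definition defect :: "'a op \<Rightarrow> 'a op" where
  "defect U = 2 *\<^sub>R id_blinfun - (U + adj U)"

lemma adj_compose_diff_id: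
  "U \<in> unitary_group N \<Longrightarrow> adj (U - id_blinfun) o\<^sub>L (U - id_blinfun) = defect U"
  using unitaryD[of U] by (simp add: defect_def compose_simps scaleR_2)

lemma adj_compose_add_id:
  assumes "U \<in> unitary_group N"
  shows "adj (U + id_blinfun) o\<^sub>L (U + id_blinfun) = 4 *\<^sub>R id_blinfun - defect U"
proof -
  have "4 *\<^sub>R id_blinfun = 2 *\<^sub>R id_blinfun + 2 *\<^sub>R (id_blinfun :: 'a op)" by (simp flip: scaleR_add_left)
  then show ?thesis
    using unitaryD[OF assms] by (simp add: defect_def compose_simps scaleR_2)
qed

lemma defect_mem: "U \<in> N \<Longrightarrow> defect U \<in> N"
  by (auto simp: defect_def)

lemma defect_selfadj: "U \<in> N \<Longrightarrow> selfadj (defect U)"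
  by (simp add: selfadj_def defect_def add.commute)

text \<open>Both \<open>B\<close> and \<open>4 - B\<close> have the form \<open>adj X X\<close>,
  with \<open>X = U - 1\<close> and \<open>X = U + 1\<close>.\<close>

lemma real_spectrum_defect:
  assumes U: "U \<in> unitary_group N"
  shows "real_spectrum (defect U) \<subseteq> {0..4}"
proof (rule real_spectrum_bounds)
  note UN = unitaryD(1)[OF U]
  show "defect U \<in> bounded_ops" using defect_mem[OF UN] by auto
  fix x
  show "0 * (norm x)\<^sup>2 \<le> inner x (defect U x)"
    using inner_adj_compose[of "U - id_blinfun" x] UN
    unfolding adj_compose_diff_id[OF U] by simp
  show "inner x (defect U x) \<le> 4 * (norm x)\<^sup>2"
  proof -
    have "0 \<le> inner x ((4 *\<^sub>R id_blinfun - defect U) x)"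
      using inner_adj_compose[of "U + id_blinfun" x] UN
      unfolding adj_compose_add_id[OF U] by simp
    then show ?thesis
      by (simp add: blinfun.bilinear_simps inner_simps power2_norm_eq_inner)
  qed
qed

lemma defect_compose:
  assumes U: "U \<in> unitary_group N"
  shows "4 *\<^sub>R defect U - (defect U o\<^sub>L defect U) = adj (U - adj U) o\<^sub>L (U - adj U)"
proof -
  have "4 *\<^sub>R A = 2 *\<^sub>R A + 2 *\<^sub>R A" for A :: "'a op" by (simp flip: scaleR_add_left)
  then show ?thesis
    using unitaryD[OF U] by (simp add: defect_def compose_simps scaleR_2 algebra_simps)
qed

context
  fixes U and s :: real
  assumes U: "U \<in> unitary_group N" and s: "0 < s"
begin

private lemmas UN = unitaryD(1)[OF U]
private lemmas fc = defect_selfadj[OF UN] real_spectrum_defect[OF U]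

private lemma cont:
  "continuous_on {0..4} (\<lambda>t::real. t powr s)"
  "continuous_on {0..4} (\<lambda>t::real. (4 - t) powr s)"
  by (rule continuous_on_powr'; use s in \<open>auto intro!: continuous_intros\<close>)+

lemma cfc_poly_defect:
  "cfc (\<lambda>t. c * (t * (4 - t))) (defect U) = c *\<^sub>R (4 *\<^sub>R defect U - (defect U o\<^sub>L defect U))"
  "cfc (\<lambda>t. c * (4 - t)) (defect U) = c *\<^sub>R (4 *\<^sub>R id_blinfun - defect U)"
proof -
  have 1: "poly [:0, 4 * c, - c:] = (\<lambda>t. c * (t * (4 - t)))" "poly [:4 * c, - c:] = (\<lambda>t. c * (4 - t))"
    by (auto simp: fun_eq_iff algebra_simps)
  show "cfc (\<lambda>t. c * (t * (4 - t))) (defect U) = c *\<^sub>R (4 *\<^sub>R defect U - (defect U o\<^sub>L defect U))"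
    "cfc (\<lambda>t. c * (4 - t)) (defect U) = c *\<^sub>R (4 *\<^sub>R id_blinfun - defect U)"
    unfolding 1[symmetric] cfc_poly[OF fc(1)]
    by (simp_all add: op_poly_pCons compose_simps algebra_simps)
qed

lemma cfc_powr_complement:
  "cfc (\<lambda>t. t powr s) (4 *\<^sub>R id_blinfun - defect U) = cfc (\<lambda>t. (4 - t) powr s) (defect U)"
proof -
  have eq: "4 *\<^sub>R id_blinfun - defect U = cfc (\<lambda>t. 4 - t) (defect U)"
    using cfc_poly_defect(2)[of 1] by simp
  have "continuous_on {0..4} (\<lambda>t::real. 4 - t)" by (intro continuous_intros)
  then show ?thesis unfolding eq by (rule cfc_compose[OF fc _ cont(1)]) auto
qed

text \<open>With \<open>s = p / 2\<close>, the right-hand side is the sum of the p-th powers of the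
  distances of \<open>U\<close> from 1 and -1, which is how the isometry sees it.\<close>

lemma tr_cfc_powr_sum:
  "Re (\<tau> (cfc (\<lambda>t. t powr s + (4 - t) powr s) (defect U))) =
   Re (\<tau> (cfc (\<lambda>t. t powr s) (defect U))) +
   Re (\<tau> (cfc (\<lambda>t. t powr s) (4 *\<^sub>R id_blinfun - defect U)))"
  using cfc_mem[OF defect_mem[OF UN] fc] cont
  by (simp add: cfc_powr_complement cfc_add[OF fc cont] tr_add)

text \<open>Self-adjointness gives \<open>B^2 = 4 B\<close>, so the spectrum of \<open>B\<close>
  lies in the two points 0 and 4, where the function equals \<open>4 powr s\<close> because
  \<open>0 powr s = 0\<close>.\<close>

lemma tr_cfc_powr_sum_symmetry:
  assumes "adj U = U"
  shows "Re (\<tau> (cfc (\<lambda>t. t powr s + (4 - t) powr s) (defect U))) = 4 powr s"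
proof -
  have q: "4 *\<^sub>R defect U - (defect U o\<^sub>L defect U) = 0"
    using defect_compose[OF U] assms by simp
  have "t = 0 \<or> t = 4" if "t \<in> real_spectrum (defect U)" for t
  proof (rule ccontr)
    assume t: "\<not> (t = 0 \<or> t = 4)"
    define B where "B = defect U - t *\<^sub>R id_blinfun"
    define C where "C = defect U - (4 - t) *\<^sub>R id_blinfun"
    \<comment> \<open>By \<open>q\<close> the product \<open>(B - t) (B - (4 - t))\<close>, with the
      defect as \<open>B\<close>, collapses to the scalar \<open>t (4 - t)\<close>, which is nonzero
      away from 0 and 4.\<close>
    have BC: "B o\<^sub>L C = scalar_op (complex_of_real (t * (4 - t)))"
      unfolding scalar_op_of_real using q by (simp add: B_def C_def compose_simps algebra_simps)
    have CB: "C o\<^sub>L B = scalar_op (complex_of_real (t * (4 - t)))"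
      unfolding scalar_op_of_real using q by (simp add: B_def C_def compose_simps algebra_simps)
    have "invertible_op (B o\<^sub>L C)" 
      unfolding BC using t by (intro invertible_scalar_op) (simp del: of_real_mult of_real_diff)
    then have "invertible_op B"
      using BC CB fc(1) by (intro invertible_op_factor[of B C]) (auto simp: B_def C_def)
    then show False using that by (simp add: real_spectrum_iff B_def)
  qed
  then have "cfc (\<lambda>t. t powr s + (4 - t) powr s) (defect U) = cfc (\<lambda>_. 4 powr s) (defect U)"
    by (intro cfc_cong) force
  then show ?thesis by (simp add: cfc_const[OF fc(1)] tr_scaleR)
qed

text \<open>Taking the trace of \<open>powr_sum_deviation_4\<close> at \<open>B\<close> bounds a
  positive multiple of the trace of \<open>B (4 - B) = |U - adj U|^2\<close> by 0, and faithfulness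
  applies.\<close>

lemma symmetry_if_tr_cfc_powr_sum:
  assumes "s \<noteq> 1"
    and eq: "Re (\<tau> (cfc (\<lambda>t. t powr s + (4 - t) powr s) (defect U))) = 4 powr s"
  shows "adj U = U"
proof -
  let ?f = "\<lambda>t::real. t powr s + (4 - t) powr s"
  obtain c \<sigma> where "0 < c"
    and c: "\<And>t. t \<in> {0..4} \<Longrightarrow> c * (t * (4 - t)) \<le> \<sigma> * (?f t - 4 powr s)"
    using powr_sum_deviation_4[OF s assms(1)] by blast
  have cf: "continuous_on {0..4} ?f" by (intro continuous_intros cont)
  have f: "cfc (\<lambda>t. \<sigma> * (?f t - 4 powr s)) (defect U)
      = \<sigma> *\<^sub>R (cfc ?f (defect U) - (4 powr s) *\<^sub>R id_blinfun)"
    by (simp add: cfc_scaleR[OF fc] cfc_diff[OF fc] cfc_const[OF fc(1)] cf continuous_on_diff)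
  have mem: "cfc ?f (defect U) \<in> N" by (rule cfc_mem[OF defect_mem[OF UN] fc cf])
  have "Re (\<tau> (cfc (\<lambda>t. c * (t * (4 - t))) (defect U)))
      \<le> Re (\<tau> (cfc (\<lambda>t. \<sigma> * (?f t - 4 powr s)) (defect U)))"
    by (intro Re_tr_mono cfc_mono[OF fc] cfc_mem[OF defect_mem[OF UN] fc] continuous_intros cf c)
  also have "\<dots> = 0" unfolding f using mem eq by (simp add: tr_simps)
  finally have "c * Re (\<tau> (adj (U - adj U) o\<^sub>L (U - adj U))) \<le> 0"
    using UN by (simp add: cfc_poly_defect defect_compose[OF U] tr_scaleR)
  then have "Re (\<tau> (adj (U - adj U) o\<^sub>L (U - adj U))) \<le> 0"
    using \<open>0 < c\<close> by (simp add: mult_le_0_iff)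
  then have "U - adj U = 0" using UN by (intro tr_adj_compose_faithful) auto
  then show ?thesis by simp
qed

text \<open>Singles out -1 as the unitary farthest from 1: \<open>4 powr s - t powr s\<close>
  dominates a multiple of \<open>4 - t\<close>, so equality of traces kills the trace of
  \<open>4 - B = |U + 1|^2\<close>.\<close>

lemma tr_cfc_powr_max:
  assumes eq: "Re (\<tau> (cfc (\<lambda>t. t powr s) (defect U))) = 4 powr s"
  shows "U = - id_blinfun"
proof -
  \<comment> \<open>The slope from \<open>one_minus_powr_ge\<close> at \<open>t / 4\<close>,
    rescaled; the last factor comes from \<open>1 - t / 4 = (4 - t) / 4\<close>.\<close>
  define c where "c = 4 powr s * (s / (1 + s)) / 4"
  have "0 < c" using s by (simp add: c_def)
  have c: "c * (4 - t) \<le> 4 powr s - t powr s" if "t \<in> {0..4}" for t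
  proof -
    have "4 powr s * (s / (1 + s) * (1 - t / 4)) \<le> 4 powr s * (1 - (t / 4) powr s)"
      using one_minus_powr_ge[of "t / 4" s] that s by (intro mult_left_mono) auto
    also have "\<dots> = 4 powr s - t powr s"
      using that powr_mult[of 4 "t / 4" s] by (simp add: right_diff_distrib)
    also have "4 powr s * (s / (1 + s) * (1 - t / 4)) = c * (4 - t)"
      using s by (simp add: c_def field_simps)
    finally show ?thesis .
  qed
  have mem: "cfc (\<lambda>t. t powr s) (defect U) \<in> N" by (rule cfc_mem[OF defect_mem[OF UN] fc cont(1)])
  have "Re (\<tau> (cfc (\<lambda>t. c * (4 - t)) (defect U))) \<le> Re (\<tau> (cfc (\<lambda>t. 4 powr s - t powr s) (defect U)))"
    by (intro Re_tr_mono cfc_mono[OF fc] cfc_mem[OF defect_mem[OF UN] fc] continuous_intros cont(1) c)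
  also have "\<dots> = 0"
    using mem eq by (simp add: cfc_diff[OF fc] cfc_const[OF fc(1)] cont(1) tr_simps)
  finally have "c * Re (\<tau> (adj (U + id_blinfun) o\<^sub>L (U + id_blinfun))) \<le> 0"
    unfolding adj_compose_add_id[OF U]
    using UN defect_mem[OF UN] by (simp add: cfc_poly_defect tr_scaleR)
  then have "Re (\<tau> (adj (U + id_blinfun) o\<^sub>L (U + id_blinfun))) \<le> 0"
    using \<open>0 < c\<close> by (simp add: mult_le_0_iff)
  then have "U + id_blinfun = 0" using UN by (intro tr_adj_compose_faithful) auto
  then show ?thesis by (simp add: eq_neg_iff_add_eq_0)
qed

end

lemma tr_cfc_powr_defect_minus_id:
  "Re (\<tau> (cfc (\<lambda>t. t powr s) (defect (- id_blinfun)))) = 4 powr s"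
proof -
  have "defect (- id_blinfun) = 2 *\<^sub>R id_blinfun + 2 *\<^sub>R id_blinfun"
    by (simp add: defect_def scaleR_2)
  then have d: "defect (- id_blinfun) = 4 *\<^sub>R id_blinfun" by (simp flip: scaleR_add_left)
  have "real_spectrum (4 *\<^sub>R id_blinfun :: 'a op) \<subseteq> {4..4}"
    by (rule real_spectrum_bounds) (auto simp: blinfun.scaleR_left power2_norm_eq_inner)
  then have "cfc (\<lambda>t. t powr s) (4 *\<^sub>R id_blinfun :: 'a op) = cfc (\<lambda>_. 4 powr s) (4 *\<^sub>R id_blinfun)"
    by (intro cfc_cong) auto
  then show ?thesis by (simp add: d cfc_const tr_scaleR)
qed

lemma Lp_norm_2_powr:
  assumes U: "U \<in> unitary_group N" and V: "V \<in> unitary_group N"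
  shows "Lp_norm \<tau> 2 (U - V) powr 2 = 2 - 2 * Re (\<tau> (adj U o\<^sub>L V))"
proof -
  note UN = unitaryD[OF U] and VN = unitaryD[OF V]
  let ?X = "U - V"
  have X: "?X \<in> bounded_ops" using UN VN by auto
  \<comment> \<open>\<open>t powr 1\<close> agrees with \<open>t\<close> only for nonnegative
    \<open>t\<close>, hence the appeal to the spectrum.\<close>
  have "cfc (\<lambda>t. t powr (2 / 2)) (adj ?X o\<^sub>L ?X) = cfc (poly [:0, 1:]) (adj ?X o\<^sub>L ?X)"
    using real_spectrum_adj_compose[OF X] by (intro cfc_cong) auto
  also have "\<dots> = adj ?X o\<^sub>L ?X"
    by (simp add: cfc_poly[OF selfadj_adj_compose[OF X]] op_poly_pCons)
  also have "\<dots> = 2 *\<^sub>R id_blinfun - (adj U o\<^sub>L V) - (adj V o\<^sub>L U)"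
    using UN VN by (simp add: compose_simps scaleR_2)
  finally have "Lp_norm \<tau> 2 ?X powr 2 = 2 - Re (\<tau> (adj U o\<^sub>L V)) - Re (\<tau> (adj V o\<^sub>L U))"
    using UN VN by (subst Lp_norm_powr) (auto simp: tr_simps)
  moreover have "Re (\<tau> (adj V o\<^sub>L U)) = Re (\<tau> (adj U o\<^sub>L V))"
    using Re_tr_adj[of "adj V o\<^sub>L U"] UN VN by simp
  ultimately show ?thesis by simp
qed

end

section \<open>Transfer of symmetries along the isometry\<close>

lemma tracial_vn_algebra_finite_factor:
  "finite_factor N \<Longrightarrow> factor_trace N \<tau> \<Longrightarrow> tracial_vn_algebra N \<tau>"
  by (simp add: tracial_vn_algebra_def finite_factor_def factor_def factor_trace_def)

text \<open>Carries the trace inequality of the symmetry \<open>S\<close> over to \<open>T\<close>,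
  where it characterises self-adjointness. Matching traces replace the map, so that the same
  statement serves both directions of the equivalence.\<close>

lemma selfadj_transfer_L2:
  assumes "tracial_vn_algebra N\<^sub>1 \<tau>\<^sub>1" "tracial_vn_algebra N\<^sub>2 \<tau>\<^sub>2"
    and S: "S \<in> unitary_group N\<^sub>1" "adj S = S" and T: "T \<in> unitary_group N\<^sub>2"
    and ST: "Re (\<tau>\<^sub>1 S) = Re (\<tau>\<^sub>2 T)"
    and ex: "\<And>W. W \<in> unitary_group N\<^sub>2 \<Longrightarrow> \<exists>V\<in>unitary_group N\<^sub>1.
      Re (\<tau>\<^sub>1 V) = Re (\<tau>\<^sub>2 W) \<and> Re (\<tau>\<^sub>1 (adj S o\<^sub>L V)) = Re (\<tau>\<^sub>2 (adj T o\<^sub>L W))"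
  shows "adj T = T"
proof -
  interpret N1: tracial_vn_algebra N\<^sub>1 \<tau>\<^sub>1 by fact
  interpret N2: tracial_vn_algebra N\<^sub>2 \<tau>\<^sub>2 by fact
  show ?thesis
  proof (rule N2.selfadj_if_tr_le[OF T])
    fix W assume "W \<in> unitary_group N\<^sub>2"
    then obtain V where V: "V \<in> unitary_group N\<^sub>1"
      and eq: "Re (\<tau>\<^sub>1 V) = Re (\<tau>\<^sub>2 W)" "Re (\<tau>\<^sub>1 (adj S o\<^sub>L V)) = Re (\<tau>\<^sub>2 (adj T o\<^sub>L W))"
      using ex by blast
    show "Re (\<tau>\<^sub>2 (adj T o\<^sub>L W)) - Re (\<tau>\<^sub>2 (adj T)) \<le> 1 - Re (\<tau>\<^sub>2 W)"
      using N1.Re_tr_symmetry_le[OF S V] eq ST S(2) N2.Re_tr_adj[OF N2.unitaryD(1)[OF T]] by simp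
  qed
qed

theorem lemma2p3:
  fixes p :: real
    and N\<^sub>1 :: "('a::chilbert_space) op set" and \<tau>\<^sub>1 :: "'a op \<Rightarrow> complex"
    and N\<^sub>2 :: "('b::chilbert_space) op set" and \<tau>\<^sub>2 :: "'b op \<Rightarrow> complex"
    and \<psi> :: "'a op \<Rightarrow> 'b op"
  assumes "0 < p"
    and "finite_factor N\<^sub>1" and "factor_trace N\<^sub>1 \<tau>\<^sub>1"
    and "finite_factor N\<^sub>2" and "factor_trace N\<^sub>2 \<tau>\<^sub>2"
    and "Lp_isometry p N\<^sub>1 \<tau>\<^sub>1 N\<^sub>2 \<tau>\<^sub>2 \<psi>"
    and "\<psi> ` unitary_group N\<^sub>1 = unitary_group N\<^sub>2"
    and "\<psi> id_blinfun = id_blinfun"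
  shows "\<forall>U\<in>unitary_group N\<^sub>1. adj U = U \<longleftrightarrow> adj (\<psi> U) = \<psi> U"
proof -
  have vn1: "tracial_vn_algebra N\<^sub>1 \<tau>\<^sub>1" and vn2: "tracial_vn_algebra N\<^sub>2 \<tau>\<^sub>2"
    using assms by (auto intro: tracial_vn_algebra_finite_factor)
  interpret N1: tracial_vn_algebra N\<^sub>1 \<tau>\<^sub>1 by (rule vn1)
  interpret N2: tracial_vn_algebra N\<^sub>2 \<tau>\<^sub>2 by (rule vn2)
  have \<psi>: "\<psi> U \<in> unitary_group N\<^sub>2" if "U \<in> unitary_group N\<^sub>1" for U
    using assms(7) that by blast
  have iso: "Lp_norm \<tau>\<^sub>1 p (U - V) = Lp_norm \<tau>\<^sub>2 p (\<psi> U - \<psi> V)"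
    if "U \<in> unitary_group N\<^sub>1" "V \<in> unitary_group N\<^sub>1" for U V
    using assms(6) that by (auto simp: Lp_isometry_def)
  show ?thesis
  proof (cases "p = 2")
    case True
    have tr: "Re (\<tau>\<^sub>1 (adj U o\<^sub>L V)) = Re (\<tau>\<^sub>2 (adj (\<psi> U) o\<^sub>L \<psi> V))"
      if "U \<in> unitary_group N\<^sub>1" "V \<in> unitary_group N\<^sub>1" for U V
      using iso[OF that] N1.Lp_norm_2_powr[OF that] N2.Lp_norm_2_powr[OF \<psi>[OF that(1)] \<psi>[OF that(2)]]
      by (simp add: True)
    have tr1: "Re (\<tau>\<^sub>1 U) = Re (\<tau>\<^sub>2 (\<psi> U))" if "U \<in> unitary_group N\<^sub>1" for U
      using tr[OF N1.unitary_id that] by (simp add: assms(8))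
    show ?thesis
    proof (intro ballI iffI)
      fix U assume U: "U \<in> unitary_group N\<^sub>1"
      show "adj (\<psi> U) = \<psi> U" if "adj U = U"
      proof (rule selfadj_transfer_L2[OF vn1 vn2 U that \<psi>[OF U] tr1[OF U]])
        fix W assume "W \<in> unitary_group N\<^sub>2"
        \<comment> \<open>Surjectivity supplies the partner of \<open>W\<close> here; in the
          converse direction the partner of \<open>W\<close> is its image.\<close>
        then obtain V where "V \<in> unitary_group N\<^sub>1" "W = \<psi> V" using assms(7) by blast
        then show "\<exists>V\<in>unitary_group N\<^sub>1. Re (\<tau>\<^sub>1 V) = Re (\<tau>\<^sub>2 W)
            \<and> Re (\<tau>\<^sub>1 (adj U o\<^sub>L V)) = Re (\<tau>\<^sub>2 (adj (\<psi> U) o\<^sub>L W))"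
          using tr1 tr[OF U] by blast
      qed
      show "adj U = U" if "adj (\<psi> U) = \<psi> U"
      proof (rule selfadj_transfer_L2[OF vn2 vn1 \<psi>[OF U] that U tr1[OF U, symmetric]])
        fix W assume "W \<in> unitary_group N\<^sub>1"
        then show "\<exists>V\<in>unitary_group N\<^sub>2. Re (\<tau>\<^sub>2 V) = Re (\<tau>\<^sub>1 W)
            \<and> Re (\<tau>\<^sub>2 (adj (\<psi> U) o\<^sub>L V)) = Re (\<tau>\<^sub>1 (adj U o\<^sub>L W))"
          using tr1 tr[OF U] \<psi> by metis
      qed
    qed
  next
    case False
    define s where "s = p / 2"
    have s: "0 < s" "s \<noteq> 1" using assms(1) False by (auto simp: s_def)
    let ?f = "\<lambda>t::real. t powr s"
    have tr: "Re (\<tau>\<^sub>1 (cfc ?f (adj (U - V) o\<^sub>L (U - V))))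
        = Re (\<tau>\<^sub>2 (cfc ?f (adj (\<psi> U - \<psi> V) o\<^sub>L (\<psi> U - \<psi> V))))"
      if "U \<in> unitary_group N\<^sub>1" "V \<in> unitary_group N\<^sub>1" for U V
      using iso[OF that] N1.Lp_norm_powr[of "U - V" p] N2.Lp_norm_powr[of "\<psi> U - \<psi> V" p]
        N1.unitaryD(1) N2.unitaryD(1) that \<psi> assms(1) by (simp add: s_def)
    have minus: "Re (\<tau>\<^sub>1 (cfc ?f (N1.defect U))) = Re (\<tau>\<^sub>2 (cfc ?f (N2.defect (\<psi> U))))"
      if "U \<in> unitary_group N\<^sub>1" for U
      using tr[OF that N1.unitary_id] N1.adj_compose_diff_id[OF that] N2.adj_compose_diff_id[OF \<psi>[OF that]]
      by (simp add: assms(8))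
    have m1: "- id_blinfun \<in> unitary_group N\<^sub>1" by (rule N1.unitary_minus[OF N1.unitary_id])
    \<comment> \<open>The image of -1 has the same distance from 1 as -1 itself, and this extremal
      distance determines it.\<close>
    have \<psi>m1: "\<psi> (- id_blinfun) = - id_blinfun"
      using minus[OF m1] N1.tr_cfc_powr_defect_minus_id
      by (intro N2.tr_cfc_powr_max[OF \<psi>[OF m1] s(1)]) simp
    have plus: "Re (\<tau>\<^sub>1 (cfc ?f (4 *\<^sub>R id_blinfun - N1.defect U)))
        = Re (\<tau>\<^sub>2 (cfc ?f (4 *\<^sub>R id_blinfun - N2.defect (\<psi> U))))"
      if "U \<in> unitary_group N\<^sub>1" for U
      using tr[OF that m1] N1.adj_compose_add_id[OF that] N2.adj_compose_add_id[OF \<psi>[OF that]]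
      by (simp add: \<psi>m1)
    show ?thesis
    proof
      fix U assume U: "U \<in> unitary_group N\<^sub>1"
      have "adj U = U \<longleftrightarrow> Re (\<tau>\<^sub>1 (cfc (\<lambda>t. t powr s + (4 - t) powr s) (N1.defect U))) = 4 powr s"
        using N1.tr_cfc_powr_sum_symmetry[OF U s(1)] N1.symmetry_if_tr_cfc_powr_sum[OF U s] by blast
      \<comment> \<open>Both sides split into the distances from 1 and from -1, which are preserved
        by \<open>minus\<close> and \<open>plus\<close>.\<close>
      also have "\<dots> \<longleftrightarrow> Re (\<tau>\<^sub>2 (cfc (\<lambda>t. t powr s + (4 - t) powr s) (N2.defect (\<psi> U)))) = 4 powr s"
        by (simp add: N1.tr_cfc_powr_sum[OF U s(1)] N2.tr_cfc_powr_sum[OF \<psi>[OF U] s(1)]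
            minus[OF U] plus[OF U])
      also have "\<dots> \<longleftrightarrow> adj (\<psi> U) = \<psi> U"
        using N2.tr_cfc_powr_sum_symmetry[OF \<psi>[OF U] s(1)]
          N2.symmetry_if_tr_cfc_powr_sum[OF \<psi>[OF U] s] by blast
      finally show "adj U = U \<longleftrightarrow> adj (\<psi> U) = \<psi> U" .
    qed
  qed
qed

end
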